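(* Let $X$, $Y$, and $Z$ be symplectic vector spaces. Then the indexed composition operation $$\mathcal L_\bullet(X\times\overline Y)\times\mathcal L_\bullet(Y\times\overline Z)\to\mathcal L_\bullet(X\times\overline Z),\qquad \bigl((f',k'),(f'',k'')\bigr)\mapsto\bigl(f'f'',\,k'+k''+\mathcal E([f',f''])\bigr)$$ is continuous in the Sabot topologies.
   Context: Symplectic vector spaces are finite-dimensional; $\overline Y$ denotes $Y$ with its symplectic form multiplied by $-1$. For a symplectic vector space $V$, $\mathcal L(V)$ is the Lagrangian Grassmannian with its usual topology, and the indexed Lagrangian Grassmannian is $\mathcal L_\bullet(V)=\mathcal L(V)\times\mathbb Z_{\ge0}$, the union of the levels $\mathcal L_k(V)=\mathcal L(V)\times\{k\}$. Let $d(L,L')$ be the codimension of $L\cap L'$ in $L$. The sublevel operator is $S(L,k)=\{(L',j)\in\mathcal L_\bullet(V): d(L,L')\le k-j\}$, and $S(\mathcal U)=\bigcup_{p\in\mathcal U}S(p)$ for a subset $\mathcal U$. The Sabot topology on $\mathcal L_\bullet(V)$ is the topology having as a basis the sets $S(\mathcal U)$, where $\mathcal U$ ranges over the open subsets of the levels $\mathcal L_k(V)$ (usual topology). The source is given the product topology. A Lagrangian subspace of $X\times\overline Y$ is regarded as a linear canonical relation $X\leftarrow Y$, and $f'f''\subset X\times\overline Z$ is the set-theoretic composition $\{(x,z):\exists y\in Y,\ (x,y)\in f',\ (y,z)\in f''\}$, which is Lagrangian. The excess $\mathcal E([f',f''])$ is the dimension of $\{y\in Y:(0,y)\in f',\ (y,0)\in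 f''\}$. *)

theory Defs
  imports "HOL-Analysis.Analysis"
begin

text \<open>A (real, finite-dimensional) vector space is a linear subspace \<open>V\<close> of a Euclidean space;
  carriers are used because a type of class \<open>euclidean_space\<close> is never zero-dimensional.
  The values of \<open>\<omega>\<close> off \<open>V\<close> are irrelevant.\<close>

definition symplectic_space :: "'a::euclidean_space set \<Rightarrow> ('a \<Rightarrow> 'a \<Rightarrow> real) \<Rightarrow> bool" where
  "symplectic_space V \<omega> \<longleftrightarrow>
     subspace V \<and>
     (\<forall>x\<in>V. \<forall>y\<in>V. \<forall>z\<in>V. \<omega> (x + y) z = \<omega> x z + \<omega> y z) \<and>
     (\<forall>c. \<forall>x\<in>V. \<forall>y\<in>V. \<omega> (c *\<^sub>R x) y = c * \<omega> x y) \<and>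
     (\<forall>x\<in>V. \<forall>y\<in>V. \<omega> x y = - \<omega> y x) \<and>
     (\<forall>x\<in>V. (\<forall>y\<in>V. \<omega> x y = 0) \<longrightarrow> x = 0)"

definition opp_form :: "('a \<Rightarrow> 'a \<Rightarrow> real) \<Rightarrow> 'a \<Rightarrow> 'a \<Rightarrow> real" where
  "opp_form \<omega> = (\<lambda>x y. - \<omega> x y)"

definition prod_form ::
    "('a \<Rightarrow> 'a \<Rightarrow> real) \<Rightarrow> ('b \<Rightarrow> 'b \<Rightarrow> real) \<Rightarrow> 'a \<times> 'b \<Rightarrow> 'a \<times> 'b \<Rightarrow> real" where
  "prod_form \<omega> \<eta> = (\<lambda>(x, y) (x', y'). \<omega> x x' + \<eta> y y')"

definition symplectic_orthogonal ::
    "'a set \<Rightarrow> ('a \<Rightarrow> 'a \<Rightarrow> real) \<Rightarrow> 'a set \<Rightarrow> 'a set" where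
  "symplectic_orthogonal V \<omega> L = {v \<in> V. \<forall>w\<in>L. \<omega> v w = 0}"

definition lagrangians ::
    "'a::euclidean_space set \<Rightarrow> ('a \<Rightarrow> 'a \<Rightarrow> real) \<Rightarrow> 'a set set" where
  "lagrangians V \<omega> = {L. subspace L \<and> L \<subseteq> V \<and> symplectic_orthogonal V \<omega> L = L}"

definition grassmannian :: "nat \<Rightarrow> 'a::euclidean_space set \<Rightarrow> 'a set set" where
  "grassmannian k V = {L. subspace L \<and> L \<subseteq> V \<and> dim L = k}"

definition frames :: "nat \<Rightarrow> 'a::euclidean_space set \<Rightarrow> (nat \<Rightarrow> 'a) set" where
  "frames k V =
     {v \<in> {..<k} \<rightarrow>\<^sub>E V. inj_on v {..<k} \<and> independent (v ` {..<k})}"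

definition frame_topology :: "nat \<Rightarrow> 'a::euclidean_space set \<Rightarrow> (nat \<Rightarrow> 'a) topology" where
  "frame_topology k V = subtopology (product_topology (\<lambda>_. top_of_set V) {..<k}) (frames k V)"

text \<open>The Grassmannian carries the quotient topology under the map sending a \<open>k\<close>-frame to its
  span.\<close>

definition grassmannian_topology :: "nat \<Rightarrow> 'a::euclidean_space set \<Rightarrow> 'a set topology" where
  "grassmannian_topology k V =
     topology (\<lambda>U. U \<subseteq> grassmannian k V \<and>
       openin (frame_topology k V) {v \<in> frames k V. span (v ` {..<k}) \<in> U})"

lemma openin_grassmannian_topology:
  "openin (grassmannian_topology k V) U \<longleftrightarrow>
     U \<subseteq> grassmannian k V \<and>
     openin (frame_topology k V) {v \<in> frames k V. span (v ` {..<k}) \<in> U}"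
proof -
  let ?P = "\<lambda>U. {v \<in> frames k V. span (v ` {..<k}) \<in> U}"
  have "istopology (\<lambda>U. U \<subseteq> grassmannian k V \<and> openin (frame_topology k V) (?P U))"
    unfolding istopology_def
  proof (intro conjI allI impI)
    fix S T
    assume S: "S \<subseteq> grassmannian k V \<and> openin (frame_topology k V) (?P S)"
      and T: "T \<subseteq> grassmannian k V \<and> openin (frame_topology k V) (?P T)"
    show "S \<inter> T \<subseteq> grassmannian k V" using S by blast
    have "?P (S \<inter> T) = ?P S \<inter> ?P T" by blast
    then show "openin (frame_topology k V) (?P (S \<inter> T))"
      using S T by (simp add: openin_Int)
  next
    fix K
    assume K: "\<forall>S\<in>K. S \<subseteq> grassmannian k V \<and> openin (frame_topology k V) (?P S)"
    show "\<Union>K \<subseteq> grassmannian k V" using K by blast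
    have "?P (\<Union>K) = \<Union>(?P ` K)" by blast
    then show "openin (frame_topology k V) (?P (\<Union>K))"
      using K by (auto intro: openin_Union)
  qed
  then show ?thesis
    by (simp add: grassmannian_topology_def topology_inverse')
qed

text \<open>All Lagrangian subspaces of a symplectic space \<open>V\<close> have dimension \<open>dim V div 2\<close>.\<close>

definition lagrangian_topology ::
    "'a::euclidean_space set \<Rightarrow> ('a \<Rightarrow> 'a \<Rightarrow> real) \<Rightarrow> 'a set topology" where
  "lagrangian_topology V \<omega> =
     subtopology (grassmannian_topology (dim V div 2) V) (lagrangians V \<omega>)"

definition indexed_lagrangians ::
    "'a::euclidean_space set \<Rightarrow> ('a \<Rightarrow> 'a \<Rightarrow> real) \<Rightarrow> ('a set \<times> nat) set" where
  "indexed_lagrangians V \<omega> = lagrangians V \<omega> \<times> UNIV"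

definition codim :: "'a::euclidean_space set \<Rightarrow> 'a set \<Rightarrow> nat" where
  "codim L L' = dim L - dim (L \<inter> L')"

definition sublevel ::
    "'a::euclidean_space set \<Rightarrow> ('a \<Rightarrow> 'a \<Rightarrow> real) \<Rightarrow> 'a set \<times> nat \<Rightarrow> ('a set \<times> nat) set" where
  "sublevel V \<omega> = (\<lambda>(L, k).
     {(L', j) \<in> indexed_lagrangians V \<omega>. int (codim L L') \<le> int k - int j})"

text \<open>The generating family is closed under intersections up to unions, i.e. it is a basis and
  not merely a subbasis.\<close>

definition sabot_topology ::
    "'a::euclidean_space set \<Rightarrow> ('a \<Rightarrow> 'a \<Rightarrow> real) \<Rightarrow> ('a set \<times> nat) topology" where
  "sabot_topology V \<omega> =
     topology_generated_by
       {\<Union>p\<in>U \<times> {k}. sublevel V \<omega> p | U k. openin (lagrangian_topology V \<omega>) U}"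

definition excess ::
    "'b::euclidean_space set \<Rightarrow> ('a::euclidean_space \<times> 'b) set \<Rightarrow>
      ('b \<times> 'c::euclidean_space) set \<Rightarrow> nat" where
  "excess Y f' f'' = dim {y \<in> Y. (0, y) \<in> f' \<and> (y, 0) \<in> f''}"

text \<open>A relation from \<open>Y\<close> to \<open>X\<close> is a set of pairs \<open>(x, y)\<close>, so the
  composition \<open>f'f''\<close> is \<^const>\<open>relcomp\<close> in the same order of arguments.\<close>

definition indexed_comp ::
    "'b::euclidean_space set \<Rightarrow> (('a::euclidean_space \<times> 'b) set \<times> nat) \<times> (('b \<times> 'c::euclidean_space) set \<times> nat)
      \<Rightarrow> ('a \<times> 'c) set \<times> nat" where
  "indexed_comp Y = (\<lambda>((f', k'), (f'', k'')). (f' O f'', k' + k'' + excess Y f' f''))"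

end

theory Submission
  imports Defs
begin

text \<open>
  Write \<open>V = X \<times> Y' \<times> Y \<times> Z'\<close>, where a prime marks the opposite form. The relations \<open>f\<close> and \<open>g\<close>
  together are the Lagrangian \<open>L = f \<times> g\<close> of \<open>V\<close>, and their composition is the reduction
  \<open>red L = (L \<inter> C + I) / I\<close> of \<open>L\<close> along the coisotropic subspace \<open>C = {(x, y, y, z)}\<close>, whose symplectic
  orthogonal is \<open>I = {(0, y, y, 0)} \<subseteq> C\<close>. The excess is \<open>e L = dim (L \<inter> I)\<close>. Two facts about
  reduction give the theorem.

  The first is algebraic (\<open>codim_red\<close>): \<open>codim (red L) (red M) + e M \<le> codim L M + e L\<close>. It says exactly
  that \<open>(L, k) \<mapsto> (red L, k + e L)\<close> maps sublevel sets into sublevel sets, and it is a count of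
  dimensions.

  The second is topological (\<open>red_perturbation\<close>): reduction itself is not continuous, since \<open>red L'\<close> can
  jump where the excess of \<open>L'\<close> drops below that of \<open>L\<close>; but for \<open>L'\<close> near \<open>L\<close> there is a Lagrangian
  \<open>M\<close> near \<open>red L\<close> with \<open>codim M (red L') \<le> e L - e L'\<close>, so that the drop of the excess pays for the
  jump. To find \<open>M\<close>, choose a Lagrangian \<open>N\<close> with \<open>N \<inter> I = 0\<close> that differs from \<open>L\<close> only in
  codimension \<open>e L\<close> (\<open>extend_isotropic_to_lagrangian\<close>). The first fact, applied to \<open>N\<close> and \<open>L\<close>, forces
  \<open>red N = red L\<close>. Every \<open>L' = f' \<times> g'\<close> near \<open>L\<close> is \<open>T L\<close> for a symplectic \<open>T\<close> close to the identity
  (\<open>nearby_lagrangian_is_perturbation\<close>). Then \<open>T N\<close> and \<open>T L\<close> still differ only in codimension \<open>e L\<close>,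
  and \<open>T N\<close> is still transverse to \<open>I\<close>, where reduction is continuous
  (\<open>red_perturbation_transverse\<close>); so \<open>M = red (T N)\<close> is close to \<open>red N = red L\<close>, and the first fact
  for \<open>T N\<close> and \<open>T L\<close> is the required bound.

  Now let \<open>(f O g, _)\<close> lie in the sublevel of \<open>(K, k)\<close> with \<open>K\<close> in the open set \<open>U\<close>. Moving \<open>K\<close> by
  the perturbation that takes \<open>f O g\<close> to \<open>M\<close> gives a point of \<open>U\<close> that is as close in codimension
  to \<open>M\<close> as \<open>K\<close> is to \<open>f O g\<close> (\<open>nearby_lagrangian_within_codim\<close>). The triangle inequality for the
  codimension and the two facts then place the compositions of all pairs in a product of two
  basic Sabot neighbourhoods into the sublevel of some point of \<open>U \<times> {k}\<close>.
\<close>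

section \<open>Linear algebra of subspaces\<close>

lemma complement_in_subspace:
  fixes K S :: "'a::euclidean_space set"
  assumes "subspace K" "subspace S" "K \<subseteq> S"
  obtains D where "subspace D" "D \<subseteq> S" "K \<inter> D = {0}" "dim D + dim K = dim S"
    "{x + y | x y. x \<in> K \<and> y \<in> D} = S"
proof -
  define D where "D = {y \<in> S. \<forall>x\<in>K. orthogonal x y}"
  have sub: "subspace D"
    using assms(2) unfolding D_def subspace_def by (auto simp: orthogonal_clauses)
  have DS: "D \<subseteq> S" by (auto simp: D_def)
  have dims: "dim D + dim K = dim S"
    unfolding D_def by (rule dim_subspace_orthogonal_to_vectors[OF assms])
  have KD: "K \<inter> D = {0}"
    using sub subspace_0[OF assms(1)] subspace_0[OF sub] by (auto simp: D_def orthogonal_def)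
  let ?T = "{x + y | x y. x \<in> K \<and> y \<in> D}"
  have "dim ?T + dim (K \<inter> D) = dim K + dim D"
    by (rule dim_sums_Int[OF assms(1) sub])
  then have "dim S \<le> dim ?T" using KD dims by simp
  moreover have "?T \<subseteq> S" using assms(2,3) DS by (auto intro: subspace_add)
  ultimately have "?T = S"
    by (intro subspace_dim_equal subspace_sums assms sub) auto
  then show ?thesis using that[OF sub DS KD dims] by simp
qed

text \<open>Addition embeds \<open>A \<times> B\<close> linearly; the first component of a left inverse is the projection.\<close>

lemma projection_along:
  fixes A B :: "'a::euclidean_space set"
  assumes "subspace A" "subspace B" "A \<inter> B = {0}"
  obtains P where "linear P" "\<And>a. a \<in> A \<Longrightarrow> P a = a" "\<And>b. b \<in> B \<Longrightarrow> P b = 0"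
proof -
  define f :: "'a \<times> 'a \<Rightarrow> 'a" where "f = (\<lambda>(a, b). a + b)"
  have lf: "linear f"
    by (rule linearI) (auto simp: f_def algebra_simps)
  have "inj_on f (A \<times> B)"
  proof (rule inj_onI, clarify)
    fix a b a' b' assume *: "a \<in> A" "b \<in> B" "a' \<in> A" "b' \<in> B" "f (a, b) = f (a', b')"
    then have "a - a' = b' - b" by (simp add: f_def algebra_simps)
    moreover have "a - a' \<in> A" "b' - b \<in> B" using * assms by (auto intro: subspace_diff)
    ultimately have "a - a' \<in> A \<inter> B" by simp
    then show "a = a' \<and> b = b'" using assms(3) \<open>a - a' = b' - b\<close> by auto
  qed
  then obtain g where g: "linear g" "\<forall>v\<in>A \<times> B. g (f v) = v"
    using linear_exists_left_inverse_on[OF lf subspace_Times[OF assms(1,2)]] by blast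
  have 0: "0 \<in> A" "0 \<in> B" using assms subspace_0 by auto
  show ?thesis
  proof (rule that[of "fst \<circ> g"])
    show "linear (fst \<circ> g)" by (rule linear_compose[OF g(1) linear_fst])
    show "(fst \<circ> g) a = a" if "a \<in> A" for a
      using g(2)[rule_format, of "(a, 0)"] that 0 by (simp add: f_def)
    show "(fst \<circ> g) b = 0" if "b \<in> B" for b
      using g(2)[rule_format, of "(0, b)"] that 0 by (simp add: f_def)
  qed
qed

lemma dim_linear_image_kernel:
  fixes f :: "'a::euclidean_space \<Rightarrow> 'b::euclidean_space"
  assumes "linear f" "subspace S"
  shows "dim (f ` S) + dim {x \<in> S. f x = 0} = dim S"
proof -
  have K: "subspace {x \<in> S. f x = 0}"
    using assms by (auto simp: subspace_def linear_0 linear_add linear_cmul)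
  obtain D where D: "subspace D" "D \<subseteq> S" "{x \<in> S. f x = 0} \<inter> D = {0}"
    "dim D + dim {x \<in> S. f x = 0} = dim S"
    and sum: "{x + y | x y. x \<in> {x \<in> S. f x = 0} \<and> y \<in> D} = S"
    by (rule complement_in_subspace[OF K assms(2)]) auto
  have "inj_on f D"
    using D(1-3) assms(1)
    by (subst linear_injective_on_subspace_0) auto
  then have "dim (f ` D) = dim D"
    using D(1) assms(1) by (intro dim_image_eq) (auto simp: span_eq_iff[THEN iffD2])
  moreover have "f ` S = f ` D"
  proof
    show "f ` S \<subseteq> f ` D"
    proof
      fix z assume "z \<in> f ` S"
      then obtain w where "w \<in> S" "z = f w" by auto
      then have "w \<in> {x + y | x y. x \<in> {x \<in> S. f x = 0} \<and> y \<in> D}" "z = f w" by (simp_all only: sum)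
      then obtain x y where "f x = 0" "y \<in> D" "z = f (x + y)" by auto
      then show "z \<in> f ` D" using assms(1) by (simp add: linear_add)
    qed
  qed (use D(2) in auto)
  ultimately show ?thesis using D(4) by simp
qed

lemma linear_near_identity_surj:
  fixes D :: "'a::euclidean_space set"
  assumes "linear f" "subspace D" "f ` D \<subseteq> D" "c < 1"
    and near: "\<And>d. d \<in> D \<Longrightarrow> norm (f d - d) \<le> c * norm d"
  shows "f ` D = D"
proof -
  have "d = 0" if "d \<in> D" "f d = 0" for d
  proof -
    have "norm d \<le> c * norm d" using near[OF that(1)] that(2) by simp
    then show ?thesis using \<open>c < 1\<close> mult_strict_right_mono[of c 1 "norm d"] by fastforce
  qed
  then have "inj_on f D"
    using assms(1,2) by (subst linear_injective_on_subspace_0) auto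
  then have "dim (f ` D) = dim D"
    using assms(1,2) by (intro dim_image_eq) (auto simp: span_eq_iff[THEN iffD2])
  then show ?thesis
    using assms by (intro subspace_dim_equal linear_subspace_image) auto
qed

text \<open>Inside \<open>B\<close>, the subspaces \<open>A \<inter> B\<close> and \<open>B \<inter> C\<close> meet in at least the expected dimension.\<close>

lemma codim_triangle:
  fixes A B C :: "'a::euclidean_space set"
  assumes "subspace A" "subspace B" "subspace C" "dim A = dim B"
  shows "codim A C \<le> codim A B + codim B C"
proof -
  let ?S = "{x + y | x y. x \<in> A \<inter> B \<and> y \<in> B \<inter> C}"
  have "dim ?S + dim ((A \<inter> B) \<inter> (B \<inter> C)) = dim (A \<inter> B) + dim (B \<inter> C)"
    using assms by (intro dim_sums_Int) (simp_all add: subspace_inter)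
  moreover have "dim ?S \<le> dim B" using assms(2) by (intro dim_subset) (auto intro: subspace_add)
  moreover have "dim ((A \<inter> B) \<inter> (B \<inter> C)) \<le> dim (A \<inter> C)" by (intro dim_subset) auto
  moreover have "dim (A \<inter> B) \<le> dim A" "dim (B \<inter> C) \<le> dim B" by (auto intro: dim_subset)
  ultimately show ?thesis using assms(4) unfolding codim_def by linarith
qed

section \<open>Symplectic linear algebra\<close>

locale symplectic =
  fixes V :: "'v::euclidean_space set" and \<omega> :: "'v \<Rightarrow> 'v \<Rightarrow> real"
  assumes symplectic: "symplectic_space V \<omega>"
begin

abbreviation orth :: "'v set \<Rightarrow> 'v set" where
  "orth L \<equiv> symplectic_orthogonal V \<omega> L"

definition isotropic :: "'v set \<Rightarrow> bool" where
  "isotropic W \<longleftrightarrow> subspace W \<and> W \<subseteq> V \<and> (\<forall>x\<in>W. \<forall>y\<in>W. \<omega> x y = 0)"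

lemma subspace_V: "subspace V"
  and add_left: "x \<in> V \<Longrightarrow> y \<in> V \<Longrightarrow> z \<in> V \<Longrightarrow> \<omega> (x + y) z = \<omega> x z + \<omega> y z"
  and scale_left: "x \<in> V \<Longrightarrow> y \<in> V \<Longrightarrow> \<omega> (c *\<^sub>R x) y = c * \<omega> x y"
  and skew: "x \<in> V \<Longrightarrow> y \<in> V \<Longrightarrow> \<omega> x y = - \<omega> y x"
  and nondegenerate: "x \<in> V \<Longrightarrow> (\<And>y. y \<in> V \<Longrightarrow> \<omega> x y = 0) \<Longrightarrow> x = 0"
  using symplectic unfolding symplectic_space_def by blast+

lemma V_closed: "0 \<in> V" "x \<in> V \<Longrightarrow> y \<in> V \<Longrightarrow> x + y \<in> V" "x \<in> V \<Longrightarrow> y \<in> V \<Longrightarrow> x - y \<in> V"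
  "x \<in> V \<Longrightarrow> c *\<^sub>R x \<in> V"
  using subspace_V by (auto intro: subspace_0 subspace_add subspace_diff subspace_scale)

lemma add_right: "x \<in> V \<Longrightarrow> y \<in> V \<Longrightarrow> z \<in> V \<Longrightarrow> \<omega> x (y + z) = \<omega> x y + \<omega> x z"
  using skew add_left V_closed by (metis add_uminus_conv_diff minus_add_distrib)

lemma scale_right: "x \<in> V \<Longrightarrow> y \<in> V \<Longrightarrow> \<omega> x (c *\<^sub>R y) = c * \<omega> x y"
  using skew scale_left V_closed by (metis mult_minus_right)

lemma self: "x \<in> V \<Longrightarrow> \<omega> x x = 0"
  using skew[of x x] by simp

lemma zero_left: "y \<in> V \<Longrightarrow> \<omega> 0 y = 0"
  using scale_left[of 0 y 0] V_closed by simp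

lemma zero_right: "y \<in> V \<Longrightarrow> \<omega> y 0 = 0"
  using scale_right[of y 0 0] V_closed by simp

lemma diff_left: "x \<in> V \<Longrightarrow> y \<in> V \<Longrightarrow> z \<in> V \<Longrightarrow> \<omega> (x - y) z = \<omega> x z - \<omega> y z"
  using add_left[of "x - y" y z] V_closed by simp

lemma diff_right: "x \<in> V \<Longrightarrow> y \<in> V \<Longrightarrow> z \<in> V \<Longrightarrow> \<omega> x (y - z) = \<omega> x y - \<omega> x z"
  using add_right[of x "y - z" z] V_closed by simp

lemma orth_subset: "orth S \<subseteq> V"
  by (auto simp: symplectic_orthogonal_def)

lemma subspace_orth: "S \<subseteq> V \<Longrightarrow> subspace (orth S)"
  unfolding subspace_def symplectic_orthogonal_def
  by (auto simp: V_closed zero_left subset_iff add_left scale_left)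

text \<open>The form is bilinear on the carrier \<open>V\<close> only, so the representing map is built on an
  orthonormal basis of \<open>V\<close> and its formula is recovered on the span.\<close>

lemma form_representation:
  obtains J where "linear J" "J ` V \<subseteq> V" "\<And>x y. x \<in> V \<Longrightarrow> y \<in> V \<Longrightarrow> J x \<bullet> y = \<omega> x y"
proof -
  obtain B where B: "B \<subseteq> V" "pairwise orthogonal B" "\<And>x. x \<in> B \<Longrightarrow> norm x = 1"
    "independent B" "card B = dim V" "span B = V"
    using orthonormal_basis_subspace[OF subspace_V] by blast
  have fin: "finite B" using B(4) by (rule independent_imp_finite)
  define j where "j = (\<lambda>x. \<Sum>b\<in>B. \<omega> x b *\<^sub>R b)"
  obtain J where J: "linear J" "\<And>b. b \<in> B \<Longrightarrow> J b = j b"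
    using linear_independent_extend[OF B(4), of j] by blast
  have Jj: "J x = j x" if "x \<in> V" for x
  proof -
    have "x \<in> span B" using that B(6) by simp
    then have "x \<in> V \<and> J x = j x"
    proof (induction rule: span_induct_alt)
      case base
      then show ?case using B(1) V_closed by (auto simp: j_def linear_0[OF J(1)] zero_left intro!: sum.neutral)
    next
      case (step c x y)
      have V: "x \<in> V" "y \<in> V" using step B(1) by auto
      have "J (c *\<^sub>R x + y) = c *\<^sub>R j x + j y"
        using step J by (simp add: linear_add linear_cmul)
      also have "\<dots> = (\<Sum>b\<in>B. (c * \<omega> x b + \<omega> y b) *\<^sub>R b)"
        by (simp add: j_def scaleR_sum_right sum.distrib[symmetric] scaleR_add_left)
      also have "\<dots> = j (c *\<^sub>R x + y)"
        unfolding j_def using V B(1) V_closed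
        by (intro sum.cong refl) (auto simp: add_left scale_left subset_iff)
      finally show ?case using V V_closed by simp
    qed
    then show ?thesis ..
  qed
  show ?thesis
  proof
    show "linear J" by fact
    show "J ` V \<subseteq> V"
      using B(1) Jj subspace_V by (auto simp: j_def intro!: subspace_sum subspace_scale)
    fix x y assume x: "x \<in> V" and y: "y \<in> V"
    have "y \<in> span B" using y B(6) by simp
    then have "y \<in> V \<and> J x \<bullet> y = \<omega> x y"
    proof (induction rule: span_induct_alt)
      case base
      then show ?case using x V_closed by (simp add: zero_right)
    next
      case (step c b y)
      have V: "b \<in> V" "y \<in> V" using step B(1) by auto
      have "j x \<bullet> b = (\<Sum>b'\<in>B. if b' = b then \<omega> x b else 0)"
        unfolding j_def inner_sum_left
      proof (rule sum.cong[OF refl])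
        fix b' assume "b' \<in> B"
        show "(\<omega> x b' *\<^sub>R b') \<bullet> b = (if b' = b then \<omega> x b else 0)"
          using B(2) B(3)[of b] step.hyps(1) \<open>b' \<in> B\<close>
          by (auto simp: pairwise_def orthogonal_def norm_eq_1)
      qed
      then have "j x \<bullet> b = \<omega> x b" using fin step.hyps(1) by simp
      then show ?case
        using step V x Jj[OF x] V_closed by (simp add: inner_add_right add_right scale_right)
    qed
    then show "J x \<bullet> y = \<omega> x y" ..
  qed
qed

text \<open>Nondegeneracy makes the representing map \<open>J\<close> an isomorphism of \<open>V\<close>, and it carries the
  symplectic orthogonal of \<open>L\<close> to the Euclidean one.\<close>

lemma dim_orth:
  assumes "subspace L" "L \<subseteq> V"
  shows "dim (orth L) + dim L = dim V"
proof -
  obtain J where J: "linear J" "J ` V \<subseteq> V" "\<And>x y. x \<in> V \<Longrightarrow> y \<in> V \<Longrightarrow> J x \<bullet> y = \<omega> x y"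
    using form_representation by blast
  have "x = 0" if "x \<in> V" "J x = 0" for x
    using J(3)[OF that(1)] that by (intro nondegenerate) auto
  then have inj: "inj_on J V"
    using J(1) subspace_V by (subst linear_injective_on_subspace_0) auto
  then have "dim (J ` V) = dim V"
    using J(1) subspace_V by (intro dim_image_eq) (auto simp: span_eq_iff[THEN iffD2])
  then have JV: "J ` V = V"
    using J subspace_V by (intro subspace_dim_equal linear_subspace_image) auto
  have "J ` orth L = {y \<in> V. \<forall>x\<in>L. orthogonal x y}"
  proof (intro equalityI subsetI)
    fix y assume "y \<in> J ` orth L"
    then show "y \<in> {y \<in> V. \<forall>x\<in>L. orthogonal x y}"
      using J(2,3) assms(2)
      by (fastforce simp: symplectic_orthogonal_def orthogonal_def inner_commute)
  next
    fix y assume y: "y \<in> {y \<in> V. \<forall>x\<in>L. orthogonal x y}"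
    then obtain v where v: "v \<in> V" "y = J v" using JV by auto
    have "\<omega> v w = 0" if "w \<in> L" for w
      using y v that J(3)[OF v(1), of w] assms(2) by (auto simp: orthogonal_def inner_commute)
    then have "v \<in> orth L" using v(1) by (simp add: symplectic_orthogonal_def)
    then show "y \<in> J ` orth L" using v by auto
  qed
  moreover have "dim (J ` orth L) = dim (orth L)"
    using J(1) subspace_orth[OF assms(2)] inj_on_subset[OF inj orth_subset]
    by (intro dim_image_eq) (auto simp: span_eq_iff[THEN iffD2])
  ultimately show ?thesis
    using dim_subspace_orthogonal_to_vectors[OF assms(1) subspace_V assms(2)] by simp
qed

lemma orth_orth:
  assumes "subspace L" "L \<subseteq> V"
  shows "orth (orth L) = L"
proof (rule subspace_dim_equal[symmetric])
  show "L \<subseteq> orth (orth L)"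
  proof
    fix x assume x: "x \<in> L"
    then have "\<omega> x w = 0" if "w \<in> orth L" for w
      using that assms(2) skew[of x w] by (auto simp: symplectic_orthogonal_def)
    then show "x \<in> orth (orth L)" using x assms(2) by (auto simp: symplectic_orthogonal_def)
  qed
  show "dim (orth (orth L)) \<le> dim L"
    using dim_orth[OF subspace_orth[OF assms(2)] orth_subset] dim_orth[OF assms] by simp
qed (use assms orth_subset subspace_orth in auto)

lemma orth_sums:
  assumes "subspace A" "subspace B" "A \<subseteq> V" "B \<subseteq> V"
  shows "orth {x + y | x y. x \<in> A \<and> y \<in> B} = orth A \<inter> orth B"
proof (intro equalityI subsetI)
  fix v assume v: "v \<in> orth {x + y | x y. x \<in> A \<and> y \<in> B}"
  have 0: "0 \<in> A" "0 \<in> B" using assms subspace_0 by auto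
  have sums: "a \<in> {x + y | x y. x \<in> A \<and> y \<in> B}" if "a \<in> A \<or> a \<in> B" for a
    using that 0 by force
  then show "v \<in> orth A \<inter> orth B" using v by (auto simp: symplectic_orthogonal_def)
next
  fix v assume "v \<in> orth A \<inter> orth B"
  then show "v \<in> orth {x + y | x y. x \<in> A \<and> y \<in> B}"
    using assms by (auto simp: symplectic_orthogonal_def add_right subset_iff)
qed

lemma isotropic_iff: "isotropic W \<longleftrightarrow> subspace W \<and> W \<subseteq> V \<and> W \<subseteq> orth W"
  by (auto simp: isotropic_def symplectic_orthogonal_def subset_iff)

lemma lagrangianD:
  assumes "L \<in> lagrangians V \<omega>"
  shows "subspace L" "L \<subseteq> V" "orth L = L" "isotropic L" "2 * dim L = dim V"
    "\<And>x y. x \<in> L \<Longrightarrow> y \<in> L \<Longrightarrow> \<omega> x y = 0"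
proof -
  show *: "subspace L" "L \<subseteq> V" "orth L = L" using assms by (auto simp: lagrangians_def)
  then show "isotropic L" by (simp add: isotropic_iff)
  then show "\<And>x y. x \<in> L \<Longrightarrow> y \<in> L \<Longrightarrow> \<omega> x y = 0" by (simp add: isotropic_def)
  show "2 * dim L = dim V" using dim_orth[OF *(1,2)] *(3) by simp
qed

lemma lagrangianI:
  assumes "isotropic L" "dim V \<le> 2 * dim L"
  shows "L \<in> lagrangians V \<omega>"
proof -
  have L: "subspace L" "L \<subseteq> V" "L \<subseteq> orth L" using assms(1) by (auto simp: isotropic_iff)
  have "dim (orth L) \<le> dim L" using dim_orth[OF L(1,2)] assms(2) by simp
  then have "L = orth L" using L subspace_orth by (intro subspace_dim_equal) auto
  then show ?thesis using L by (auto simp: lagrangians_def)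
qed

lemma lagrangians_subset_grassmannian:
  "lagrangians V \<omega> \<subseteq> grassmannian (dim V div 2) V"
  using lagrangianD by (fastforce simp: grassmannian_def)

text \<open>Greedy extension: if nothing can be adjoined to \<open>W\<close>, then \<open>orth W \<subseteq> W + I\<close>, so
  \<open>orth W \<inter> orth I \<subseteq> W\<close> by taking orthogonals; hence \<open>orth W \<inter> I\<close> lies in \<open>W \<inter> I = 0\<close>, and by the
  modular law \<open>orth W = W + (orth W \<inter> I) = W\<close>.\<close>

lemma extend_isotropic_to_lagrangian:
  assumes "isotropic W" "isotropic I" "W \<inter> I = {0}"
  obtains L where "L \<in> lagrangians V \<omega>" "W \<subseteq> L" "L \<inter> I = {0}"
proof -
  have "\<exists>L. L \<in> lagrangians V \<omega> \<and> W \<subseteq> L \<and> L \<inter> I = {0}"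
    using assms(1,3)
  proof (induction "dim V - dim W" arbitrary: W rule: less_induct)
    case less
    have W: "subspace W" "W \<subseteq> V" "W \<subseteq> orth W" using less.prems by (auto simp: isotropic_iff)
    have I: "subspace I" "I \<subseteq> V" "I \<subseteq> orth I" using assms(2) by (auto simp: isotropic_iff)
    let ?S = "{x + y | x y. x \<in> W \<and> y \<in> I}"
    show ?case
    proof (cases "orth W \<subseteq> ?S")
      case True
      have "orth ?S \<subseteq> orth (orth W)"
        unfolding symplectic_orthogonal_def[of _ _ ?S] symplectic_orthogonal_def[of _ _ "orth W"]
        using True by blast
      then have "orth W \<inter> orth I \<subseteq> W"
        by (simp add: orth_sums W I orth_orth)
      then have meet: "orth W \<inter> I \<subseteq> {0}" using I(3) less.prems(2) by blast
      have "orth W \<subseteq> W"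
      proof
        fix v assume v: "v \<in> orth W"
        then obtain x y where xy: "x \<in> W" "y \<in> I" "v = x + y" using True by auto
        have "v - x \<in> orth W"
          using v xy(1) W(3) subspace_orth[OF W(2)] by (intro subspace_diff) auto
        then have "y = 0" using meet xy by auto
        then show "v \<in> W" using xy by simp
      qed
      then have "W \<in> lagrangians V \<omega>" using W by (auto simp: lagrangians_def)
      then show ?thesis using less.prems(2) by auto
    next
      case False
      then obtain x where x: "x \<in> orth W" "x \<notin> ?S" by blast
      have xV: "x \<in> V" using x(1) orth_subset by auto
      have xW: "\<omega> x w = 0" "\<omega> w x = 0" if "w \<in> W" for w
        using x(1) that W(2) skew[of w x] xV by (auto simp: symplectic_orthogonal_def)
      define W' where "W' = span (insert x W)"
      have W': "\<exists>c. \<exists>w\<in>W. v = w + c *\<^sub>R x" if "v \<in> W'" for v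
      proof -
        obtain c where "v - c *\<^sub>R x \<in> W"
          using \<open>v \<in> W'\<close> W(1) by (auto simp: W'_def span_breakdown_eq span_eq_iff[THEN iffD2])
        then show ?thesis by (intro exI[of _ c] bexI[of _ "v - c *\<^sub>R x"]) auto
      qed
      have "isotropic W'"
        unfolding isotropic_def
      proof (intro conjI ballI)
        show "subspace W'" by (simp add: W'_def)
        show "W' \<subseteq> V" unfolding W'_def using xV W(2) subspace_V by (intro span_minimal) auto
        fix u v assume "u \<in> W'" "v \<in> W'"
        then obtain c w d z where "w \<in> W" "u = w + c *\<^sub>R x" "z \<in> W" "v = z + d *\<^sub>R x"
          using W' by meson
        moreover have "\<omega> w z = 0"
          using less.prems(1) \<open>w \<in> W\<close> \<open>z \<in> W\<close> by (simp add: isotropic_def)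
        ultimately show "\<omega> u v = 0"
          using W(2) xV xW by (simp add: subset_iff add_left add_right scale_left scale_right V_closed self)
      qed
      moreover have "W' \<inter> I = {0}"
      proof -
        have "v = 0" if "v \<in> W'" "v \<in> I" for v
        proof -
          obtain c w where cw: "w \<in> W" "v = w + c *\<^sub>R x" using W' \<open>v \<in> W'\<close> by meson
          have "c = 0"
          proof (rule ccontr)
            assume "c \<noteq> 0"
            then have "x = (- (1 / c)) *\<^sub>R w + (1 / c) *\<^sub>R v"
              using cw by (simp add: algebra_simps)
            moreover have "(- (1 / c)) *\<^sub>R w \<in> W" "(1 / c) *\<^sub>R v \<in> I"
              using cw(1) that W(1) I(1) by (auto intro: subspace_scale simp del: scaleR_minus_left)
            ultimately have "x \<in> ?S" by (intro CollectI exI conjI)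
            then show False using x(2) by simp
          qed
          then show ?thesis using cw that less.prems(2) by auto
        qed
        moreover have "0 \<in> W'" "0 \<in> I" using I(1) by (auto simp: W'_def span_zero subspace_0)
        ultimately show ?thesis by auto
      qed
      moreover have "dim V - dim W' < dim V - dim W"
      proof -
        have "x \<notin> span W"
        proof
          assume "x \<in> span W"
          then have "x \<in> W" using W(1) by (simp add: span_eq_iff[THEN iffD2])
          then have "x + 0 \<in> ?S" using subspace_0[OF I(1)] by blast
          then show False using x(2) by simp
        qed
        then have "dim W' = dim W + 1" by (simp add: W'_def dim_insert)
        moreover have "dim W' \<le> dim V" using \<open>isotropic W'\<close> by (simp add: isotropic_def dim_subset)
        ultimately show ?thesis by simp
      qed
      ultimately obtain L where "L \<in> lagrangians V \<omega>" "W' \<subseteq> L" "L \<inter> I = {0}"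
        using less.hyps by blast
      moreover have "W \<subseteq> W'" by (auto simp: W'_def intro: span_base)
      ultimately show ?thesis by blast
    qed
  qed
  then show ?thesis using that by blast
qed

end

section \<open>Neighbourhoods in the Grassmannian\<close>

text \<open>The quotient topology is compared with closeness of vectors. The two comparisons below measure
  closeness in opposite directions: openness of a set is tested by lifting vectors of \<open>L\<close> to \<open>L'\<close>,
  whereas a neighbourhood of \<open>L\<close> controls the vectors of \<open>L'\<close>. The second form gives
  transversality of \<open>L'\<close> to a complement of \<open>L\<close> at once; the first is what the image of \<open>L\<close> under a map
  near the identity visibly satisfies.\<close>

lemma orthonormal_frame:
  fixes L :: "'a::euclidean_space set"
  assumes "L \<in> grassmannian k V"
  obtains b where "b \<in> frames k V" "span (b ` {..<k}) = L"
    "pairwise orthogonal (b ` {..<k})" "\<And>i. i < k \<Longrightarrow> norm (b i) = 1"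
proof -
  have L: "subspace L" "L \<subseteq> V" "dim L = k" using assms by (auto simp: grassmannian_def)
  obtain B where B: "B \<subseteq> L" "pairwise orthogonal B" "\<And>x. x \<in> B \<Longrightarrow> norm x = 1"
    "independent B" "card B = dim L" "span B = L"
    using orthonormal_basis_subspace[OF L(1)] by blast
  obtain h where h: "bij_betw h {..<k} B"
    using finite_same_card_bij[of "{..<k}" B] B(4,5) L(3) independent_imp_finite by fastforce
  define b where "b = restrict h {..<k}"
  have im: "b ` {..<k} = B" using h by (auto simp: b_def bij_betw_def)
  show ?thesis
  proof
    show "b \<in> frames k V"
      using h im B L(2) by (auto simp: frames_def b_def bij_betw_def inj_on_def)
  qed (use im B in auto)
qed

lemma span_frame:
  assumes "L \<in> grassmannian k V" "v \<in> {..<k} \<rightarrow>\<^sub>E L" "inj_on v {..<k}" "independent (v ` {..<k})"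
  shows "v \<in> frames k V" "span (v ` {..<k}) = L"
proof -
  have L: "subspace L" "L \<subseteq> V" "dim L = k" using assms by (auto simp: grassmannian_def)
  show "v \<in> frames k V" using assms L by (auto simp: frames_def PiE_def)
  have "v ` {..<k} \<subseteq> L" using assms(2) by auto
  moreover have "dim L \<le> card (v ` {..<k})" using assms(3) L(3) by (simp add: card_image)
  ultimately show "span (v ` {..<k}) = L"
    using card_ge_dim_independent[OF _ assms(4)] span_minimal[OF _ L(1)] by blast
qed

lemma span_frame_in_grassmannian:
  assumes "subspace V" "v \<in> frames k V"
  shows "span (v ` {..<k}) \<in> grassmannian k V"
proof -
  have "v ` {..<k} \<subseteq> V" "inj_on v {..<k}" "independent (v ` {..<k})"
    using assms(2) by (auto simp: frames_def)
  then show ?thesis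
    using assms(1) dim_span_eq_card_independent[of "v ` {..<k}"] span_minimal[of "v ` {..<k}" V]
    by (auto simp: grassmannian_def card_image)
qed

text \<open>Perturbing an orthonormal basis of \<open>L\<close> by less than \<open>1 / k\<close> in each vector moves every
  vector of \<open>L\<close> by less than its norm, so the perturbed vectors stay independent; they are then
  a frame near the given one, and they span \<open>L'\<close> for dimension reasons.\<close>

lemma grassmannian_open_contains_close:
  fixes L :: "'a::euclidean_space set"
  assumes "openin (grassmannian_topology k V) U" "L \<in> U"
  obtains \<epsilon> where "\<epsilon> > 0"
    "\<And>L'. L' \<in> grassmannian k V \<Longrightarrow> (\<And>w. w \<in> L \<Longrightarrow> \<exists>v\<in>L'. norm (v - w) \<le> \<epsilon> * norm w) \<Longrightarrow> L' \<in> U"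
proof -
  have U: "U \<subseteq> grassmannian k V"
    "openin (frame_topology k V) {v \<in> frames k V. span (v ` {..<k}) \<in> U}"
    using assms(1) by (auto simp: openin_grassmannian_topology)
  obtain b where b: "b \<in> frames k V" "span (b ` {..<k}) = L"
    "pairwise orthogonal (b ` {..<k})" "\<And>i. i < k \<Longrightarrow> norm (b i) = 1"
    using orthonormal_frame U(1) assms(2) by blast
  obtain G where G: "openin (product_topology (\<lambda>_. top_of_set V) {..<k}) G"
    "{v \<in> frames k V. span (v ` {..<k}) \<in> U} = G \<inter> frames k V"
    using U(2) unfolding frame_topology_def openin_subtopology by blast
  have "b \<in> G" using b(1,2) assms(2) G(2) by blast
  then obtain N where N: "\<And>i. i < k \<Longrightarrow> openin (top_of_set V) (N i)" "b \<in> PiE {..<k} N"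
    "PiE {..<k} N \<subseteq> G"
    using G(1) unfolding openin_product_topology_alt by (metis lessThan_iff)
  have "\<exists>e>0. ball (b i) e \<inter> V \<subseteq> N i" if "i < k" for i
    using N(1)[OF that] N(2) that by (auto simp: openin_contains_ball)
  then obtain e where e: "\<And>i. i < k \<Longrightarrow> e i > 0" "\<And>i. i < k \<Longrightarrow> ball (b i) (e i) \<inter> V \<subseteq> N i"
    by metis
  \<comment> \<open>The bound by \<open>1 / (k + 1)\<close> keeps the perturbed frame independent, the others keep it in \<open>PiE _ N\<close>.\<close>
  define \<epsilon> where "\<epsilon> = Min (insert (1 / (real k + 1)) ((\<lambda>i. e i / 2) ` {..<k}))"
  have \<epsilon>0: "\<epsilon> > 0" using e(1) by (auto simp: \<epsilon>_def)
  have \<epsilon>1: "\<epsilon> \<le> 1 / (real k + 1)" by (simp add: \<epsilon>_def)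
  have \<epsilon>e: "\<epsilon> < e i" if "i < k" for i
  proof -
    have "\<epsilon> \<le> e i / 2" unfolding \<epsilon>_def using that by (intro Min_le) auto
    then show ?thesis using e(1)[OF that] by simp
  qed
  have k\<epsilon>: "real k * \<epsilon> < 1"
  proof -
    have "real k * \<epsilon> \<le> real k * (1 / (real k + 1))" using \<epsilon>1 by (intro mult_left_mono) auto
    also have "\<dots> < 1" by (simp add: field_simps)
    finally show ?thesis .
  qed
  have inj: "inj_on b {..<k}" and ind: "independent (b ` {..<k})"
    using b(1) by (auto simp: frames_def)
  show ?thesis
  proof (rule that[OF \<epsilon>0])
    fix L' assume L': "L' \<in> grassmannian k V"
      and close: "\<And>w. w \<in> L \<Longrightarrow> \<exists>v\<in>L'. norm (v - w) \<le> \<epsilon> * norm w"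
    have "\<exists>v\<in>L'. norm (v - b i) \<le> \<epsilon>" if "i < k" for i
      using close[of "b i"] b(2,4) that by (auto intro: span_base)
    then obtain v0 where v0: "\<And>i. i < k \<Longrightarrow> v0 i \<in> L'" "\<And>i. i < k \<Longrightarrow> norm (v0 i - b i) \<le> \<epsilon>"
      by metis
    define v where "v = restrict v0 {..<k}"
    have v: "v \<in> {..<k} \<rightarrow>\<^sub>E L'" "\<And>i. i < k \<Longrightarrow> norm (v i - b i) \<le> \<epsilon>"
      using v0 by (auto simp: v_def)
    obtain T where T: "linear T" "\<And>i. i < k \<Longrightarrow> T (b i) = v i"
    proof -
      obtain T where "linear T" "\<forall>x\<in>b ` {..<k}. T x = v (inv_into {..<k} b x)"
        using linear_independent_extend[OF ind, of "\<lambda>x. v (inv_into {..<k} b x)"] by blast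
      then show ?thesis using that[of T] inj by (auto simp: inv_into_f_f)
    qed
    have "x = 0" if "x \<in> L" "T x = 0" for x
    proof (rule ccontr)
      assume "x \<noteq> 0"
      have x: "x = (\<Sum>i<k. (x \<bullet> b i) *\<^sub>R b i)"
      proof -
        have "(\<Sum>i\<in>b ` {..<k}. (x \<bullet> i) *\<^sub>R i) = x"
          using that(1) b(2,4) by (intro orthonormal_basis_expand[OF b(3)]) auto
        then show ?thesis using inj by (simp add: sum.reindex)
      qed
      have "T x - x = (\<Sum>i<k. (x \<bullet> b i) *\<^sub>R (v i - b i))"
        by (subst (1 2) x) (simp add: linear_sum[OF T(1)] linear_cmul[OF T(1)] T(2)
            sum_subtractf scaleR_diff_right)
      also have "norm \<dots> \<le> (\<Sum>i<k. norm x * \<epsilon>)"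
      proof (rule sum_norm_le)
        fix i assume "i \<in> {..<k}"
        then have "\<bar>x \<bullet> b i\<bar> \<le> norm x" using Cauchy_Schwarz_ineq2[of x "b i"] b(4) by simp
        then show "norm ((x \<bullet> b i) *\<^sub>R (v i - b i)) \<le> norm x * \<epsilon>"
          using v(2)[of i] \<open>i \<in> {..<k}\<close> by (auto intro!: mult_mono)
      qed
      also have "\<dots> = (real k * \<epsilon>) * norm x" by simp
      also have "\<dots> < 1 * norm x" using k\<epsilon> \<open>x \<noteq> 0\<close> by (intro mult_strict_right_mono) auto
      finally show False using that(2) by simp
    qed
    then have injT: "inj_on T (span (b ` {..<k}))"
      using b(2) T(1) by (subst linear_injective_on_subspace_0) auto
    have vT: "v ` {..<k} = T ` b ` {..<k}" using T(2) by (auto simp: image_iff)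
    have "independent (v ` {..<k})"
      unfolding vT by (rule linear_independent_injective_image[OF T(1) ind injT])
    moreover have "inj_on v {..<k}"
    proof -
      have "inj_on (T \<circ> b) {..<k}"
        using inj injT by (intro comp_inj_on) (auto intro: inj_on_subset[OF _ span_superset])
      then show ?thesis using T(2) by (auto simp: inj_on_def)
    qed
    ultimately have "v \<in> frames k V" "span (v ` {..<k}) = L'"
      using span_frame[OF L' v(1)] by auto
    moreover have "v \<in> PiE {..<k} N"
    proof (intro PiE_I)
      fix i assume "i \<in> {..<k}"
      then have "v i \<in> ball (b i) (e i) \<inter> V"
        using v \<epsilon>e[of i] L' by (fastforce simp: dist_norm norm_minus_commute grassmannian_def)
      then show "v i \<in> N i" using e(2) \<open>i \<in> {..<k}\<close> by blast
    qed (use v(1) in \<open>auto simp: PiE_def extensional_def\<close>)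
    ultimately show "L' \<in> U" using N(3) G(2) by blast
  qed
qed

lemma frame_coordinates_bounded:
  fixes v :: "nat \<Rightarrow> 'a::euclidean_space"
  assumes "inj_on v {..<k}" "independent (v ` {..<k})"
  obtains K where "K > 0" "\<And>c. (\<Sum>i<k. \<bar>c i\<bar>) \<le> K * norm (\<Sum>i<k. c i *\<^sub>R v i)"
proof -
  have "\<exists>\<phi>. linear \<phi> \<and> (\<forall>j<k. \<phi> (v j) = (if i = j then 1 else (0::real)))" if "i < k" for i
  proof -
    obtain \<phi> where "linear \<phi>" "\<forall>x\<in>v ` {..<k}. \<phi> x = (if x = v i then 1 else (0::real))"
      using linear_independent_extend[OF assms(2), of "\<lambda>x. if x = v i then 1 else (0::real)"] by blast
    then show ?thesis using assms(1) that by (intro exI[of _ \<phi>]) (auto simp: inj_on_def)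
  qed
  then obtain \<phi> where \<phi>: "\<And>i. i < k \<Longrightarrow> linear (\<phi> i)"
    "\<And>i j. i < k \<Longrightarrow> j < k \<Longrightarrow> \<phi> i (v j) = (if i = j then 1 else (0::real))"
    by metis
  have "\<exists>B>0. \<forall>x. \<bar>\<phi> i x\<bar> \<le> B * norm x" if "i < k" for i
    using linear_bounded_pos[OF \<phi>(1)[OF that]] by (metis real_norm_def)
  then obtain B where B: "\<And>i. i < k \<Longrightarrow> B i > 0" "\<And>i x. i < k \<Longrightarrow> \<bar>\<phi> i x\<bar> \<le> B i * norm x"
    by metis
  show ?thesis
  proof
    show "0 < (\<Sum>i<k. B i) + 1" using B(1) by (smt (verit, best) lessThan_iff sum_nonneg)
    fix c :: "nat \<Rightarrow> real"
    let ?u = "\<Sum>i<k. c i *\<^sub>R v i"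
    have "c i = \<phi> i ?u" if "i < k" for i
    proof -
      have "\<phi> i ?u = (\<Sum>j<k. c j * (if i = j then 1 else 0))"
        using \<phi>(2)[OF that]
        by (simp add: linear_sum[OF \<phi>(1)[OF that]] linear_cmul[OF \<phi>(1)[OF that]])
      also have "\<dots> = (\<Sum>j<k. if j = i then c j else 0)" by (intro sum.cong) auto
      finally show ?thesis using that by simp
    qed
    then have "(\<Sum>i<k. \<bar>c i\<bar>) \<le> (\<Sum>i<k. B i * norm ?u)"
      using B(2) by (intro sum_mono) (metis lessThan_iff)
    also have "\<dots> \<le> ((\<Sum>i<k. B i) + 1) * norm ?u"
      by (simp add: sum_distrib_right distrib_right)
    finally show "(\<Sum>i<k. \<bar>c i\<bar>) \<le> ((\<Sum>i<k. B i) + 1) * norm ?u" .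
  qed
qed

text \<open>The set of all \<open>L'\<close> within \<open>\<epsilon>\<close> of \<open>L\<close> in the sense below need not be open, but the set of
  those within some \<open>e < \<epsilon>\<close> is: the slack \<open>\<epsilon> - e\<close> absorbs the change of a vector when its
  coordinates are kept and the frame is moved, because coordinates with respect to a fixed frame
  are bounded by the vector.\<close>

lemma grassmannian_close_neighbourhood:
  fixes L :: "'a::euclidean_space set"
  assumes "subspace V" "L \<in> grassmannian k V" "\<epsilon> > 0"
  obtains O' where "openin (grassmannian_topology k V) O'" "L \<in> O'"
    "\<And>L' v. L' \<in> O' \<Longrightarrow> v \<in> L' \<Longrightarrow> \<exists>w\<in>L. norm (v - w) \<le> \<epsilon> * norm v"
proof -
  define O' where "O' = {L' \<in> grassmannian k V. \<exists>e. 0 \<le> e \<and> e < \<epsilon> \<and>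
    (\<forall>v\<in>L'. \<exists>w\<in>L. norm (v - w) \<le> e * norm v)}"
  have "openin (frame_topology k V) {v \<in> frames k V. span (v ` {..<k}) \<in> O'}"
  proof (subst openin_subopen, safe)
    fix v0 assume v0: "v0 \<in> frames k V" "span (v0 ` {..<k}) \<in> O'"
    obtain e where e: "0 \<le> e" "e < \<epsilon>"
      "\<And>v. v \<in> span (v0 ` {..<k}) \<Longrightarrow> \<exists>w\<in>L. norm (v - w) \<le> e * norm v"
      using v0(2) by (auto simp: O'_def)
    obtain K where K: "K > 0" "\<And>c. (\<Sum>i<k. \<bar>c i\<bar>) \<le> K * norm (\<Sum>i<k. c i *\<^sub>R v0 i)"
      using frame_coordinates_bounded[of v0 k] v0(1) by (auto simp: frames_def)
    \<comment> \<open>Moving the frame by \<open>\<delta>\<close> moves \<open>u\<close> by at most \<open>\<eta> * norm u\<close>, which turns the bound \<open>e\<close>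
      into \<open>\<eta> * (1 + e) + e\<close>; \<open>\<eta>\<close> is chosen to make this less than \<open>\<epsilon>\<close>.\<close>
    define \<eta> where "\<eta> = min 1 ((\<epsilon> - e) / (2 * (1 + e)))"
    have \<eta>: "0 < \<eta>" "\<eta> \<le> 1" using e(1,2) by (auto simp: \<eta>_def)
    have "\<eta> * (1 + e) \<le> (\<epsilon> - e) / (2 * (1 + e)) * (1 + e)"
      using e(1) by (intro mult_right_mono) (auto simp: \<eta>_def)
    also have "\<dots> = (\<epsilon> - e) / 2" using e(1) by (simp add: field_simps)
    also have "\<dots> < \<epsilon> - e" using e(2) by simp
    finally have \<eta>\<epsilon>: "\<eta> * (1 + e) + e < \<epsilon>" by simp
    define \<delta> where "\<delta> = \<eta> / (2 * K)"
    have \<delta>: "\<delta> > 0" "\<delta> * K = \<eta> / 2" using \<eta> K(1) by (auto simp: \<delta>_def)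
    define G where "G = PiE {..<k} (\<lambda>i. V \<inter> ball (v0 i) \<delta>)"
    have "openin (product_topology (\<lambda>_. top_of_set V) {..<k}) G"
      unfolding G_def by (simp add: openin_PiE openin_open_Int)
    then have "openin (frame_topology k V) (G \<inter> frames k V)"
      unfolding frame_topology_def openin_subtopology by blast
    moreover have "v0 \<in> G \<inter> frames k V"
      using v0(1) \<delta>(1) by (auto simp: G_def frames_def PiE_def)
    moreover have "span (v ` {..<k}) \<in> O'" if v: "v \<in> G" "v \<in> frames k V" for v
    proof -
      have near: "norm (v i - v0 i) \<le> \<delta>" if "i < k" for i
        using v(1) that by (auto simp: G_def PiE_iff dist_norm norm_minus_commute intro: less_imp_le)
      have "\<exists>w\<in>L. norm (u - w) \<le> (\<eta> * (1 + e) + e) * norm u" if "u \<in> span (v ` {..<k})" for u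
      proof -
        obtain c' where "u = (\<Sum>x\<in>v ` {..<k}. c' x *\<^sub>R x)"
          using \<open>u \<in> span (v ` {..<k})\<close> by (auto simp: span_finite)
        moreover have "inj_on v {..<k}" using v(2) by (simp add: frames_def)
        ultimately obtain c where u: "u = (\<Sum>i<k. c i *\<^sub>R v i)"
          by (auto simp: sum.reindex)
        \<comment> \<open>the vector with the same coordinates in the unperturbed frame\<close>
        define u0 where "u0 = (\<Sum>i<k. c i *\<^sub>R v0 i)"
        have "u - u0 = (\<Sum>i<k. c i *\<^sub>R (v i - v0 i))"
          by (simp add: u u0_def sum_subtractf scaleR_diff_right)
        also have "norm \<dots> \<le> (\<Sum>i<k. \<bar>c i\<bar> * \<delta>)"
          using near by (intro sum_norm_le) (auto intro: mult_left_mono)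
        also have "\<dots> \<le> \<delta> * (K * norm u0)"
          using mult_left_mono[OF K(2)[of c] less_imp_le[OF \<delta>(1)]]
          by (simp add: sum_distrib_left[symmetric] u0_def mult.commute[of _ \<delta>])
        also have "\<dots> = \<eta> / 2 * norm u0" using \<delta>(2) by (simp add: mult.assoc[symmetric])
        finally have d: "norm (u - u0) \<le> \<eta> / 2 * norm u0" .
        have "\<eta> / 2 * norm u0 \<le> 1 / 2 * norm u0" using \<eta> by (intro mult_right_mono) auto
        then have n: "norm u0 \<le> 2 * norm u"
          using d norm_triangle_ineq2[of u0 u] by (simp add: norm_minus_commute)
        have "\<eta> / 2 * norm u0 \<le> \<eta> / 2 * (2 * norm u)" using n \<eta> by (intro mult_left_mono) auto
        then have d': "norm (u - u0) \<le> \<eta> * norm u" using d by simp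
        have n': "norm u0 \<le> (1 + \<eta>) * norm u"
          using d' norm_triangle_ineq2[of u0 u] by (simp add: norm_minus_commute distrib_right)
        have "u0 \<in> span (v0 ` {..<k})"
          unfolding u0_def by (intro span_sum span_scale span_base) auto
        then obtain w where w: "w \<in> L" "norm (u0 - w) \<le> e * norm u0" using e(3) by blast
        have "norm (u - w) \<le> norm (u - u0) + norm (u0 - w)"
          using norm_triangle_ineq[of "u - u0" "u0 - w"] by simp
        also have "\<dots> \<le> \<eta> * norm u + e * ((1 + \<eta>) * norm u)"
          using d' w(2) mult_left_mono[OF n' e(1)] by simp
        finally show ?thesis using w(1) by (intro bexI[of _ w]) (auto simp: algebra_simps)
      qed
      moreover have "0 \<le> \<eta> * (1 + e) + e" using \<eta> e(1) by simp
      ultimately show ?thesis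
        using \<eta>\<epsilon> span_frame_in_grassmannian[OF assms(1) v(2)] unfolding O'_def by blast
    qed
    ultimately show "\<exists>T. openin (frame_topology k V) T \<and> v0 \<in> T \<and>
        T \<subseteq> {v \<in> frames k V. span (v ` {..<k}) \<in> O'}"
      by (intro exI[of _ "G \<inter> frames k V"]) auto
  qed
  then have "openin (grassmannian_topology k V) O'"
    by (auto simp: openin_grassmannian_topology O'_def)
  moreover have "L \<in> O'"
    using assms(2,3) by (auto simp: O'_def intro!: exI[of _ 0] bexI)
  moreover have "\<exists>w\<in>L. norm (v - w) \<le> \<epsilon> * norm v" if "L' \<in> O'" "v \<in> L'" for L' v
  proof -
    obtain e w where "e < \<epsilon>" "w \<in> L" "norm (v - w) \<le> e * norm v"
      using \<open>L' \<in> O'\<close> \<open>v \<in> L'\<close> unfolding O'_def by blast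
    moreover have "e * norm v \<le> \<epsilon> * norm v" using \<open>e < \<epsilon>\<close> by (intro mult_right_mono) auto
    ultimately show ?thesis by (intro bexI[of _ w]) auto
  qed
  ultimately show ?thesis using that by blast
qed

section \<open>Small symplectic perturbations\<close>

context symplectic
begin

text \<open>Only the restriction to \<open>V\<close> matters; linearity on the whole type lets the map be composed
  and bounded like any linear map between Euclidean spaces.\<close>

definition symplectic_perturbation :: "real \<Rightarrow> ('v \<Rightarrow> 'v) \<Rightarrow> bool" where
  "symplectic_perturbation \<epsilon> T \<longleftrightarrow> linear T \<and> T ` V \<subseteq> V \<and>
     (\<forall>x\<in>V. \<forall>y\<in>V. \<omega> (T x) (T y) = \<omega> x y) \<and> (\<forall>x\<in>V. norm (T x - x) \<le> \<epsilon> * norm x)"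

lemma symplectic_perturbationD:
  assumes "symplectic_perturbation \<epsilon> T"
  shows "linear T" "x \<in> V \<Longrightarrow> T x \<in> V"
    "x \<in> V \<Longrightarrow> y \<in> V \<Longrightarrow> \<omega> (T x) (T y) = \<omega> x y" "x \<in> V \<Longrightarrow> norm (T x - x) \<le> \<epsilon> * norm x"
  using assms by (auto simp: symplectic_perturbation_def)

lemma symplectic_perturbation_inj:
  assumes "symplectic_perturbation \<epsilon> T"
  shows "inj_on T V"
proof -
  have "x = 0" if "x \<in> V" "T x = 0" for x
  proof (rule nondegenerate[OF that(1)])
    fix y assume "y \<in> V"
    then show "\<omega> x y = 0"
      using symplectic_perturbationD(2,3)[OF assms] that zero_left by metis
  qed
  then show ?thesis
    using symplectic_perturbationD(1)[OF assms] subspace_V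
    by (subst linear_injective_on_subspace_0) auto
qed

lemma symplectic_perturbation_dim:
  assumes "symplectic_perturbation \<epsilon> T" "subspace A" "A \<subseteq> V"
  shows "dim (T ` A) = dim A"
  using symplectic_perturbationD(1)[OF assms(1)] assms(2)
    inj_on_subset[OF symplectic_perturbation_inj[OF assms(1)] assms(3)]
  by (intro dim_image_eq) (auto simp: span_eq_iff[THEN iffD2])

lemma symplectic_perturbation_lagrangian:
  assumes "symplectic_perturbation \<epsilon> T" "L \<in> lagrangians V \<omega>"
  shows "T ` L \<in> lagrangians V \<omega>"
proof (rule lagrangianI)
  note L = lagrangianD[OF assms(2)] and T = symplectic_perturbationD[OF assms(1)]
  show "isotropic (T ` L)"
    unfolding isotropic_def using L(1,2,6) T by (auto intro: linear_subspace_image simp: subset_iff)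
  show "dim V \<le> 2 * dim (T ` L)"
    using symplectic_perturbation_dim[OF assms(1) L(1,2)] L(5) by simp
qed

lemma symplectic_perturbation_codim:
  assumes "symplectic_perturbation \<epsilon> T" "L \<in> lagrangians V \<omega>" "M \<in> lagrangians V \<omega>"
  shows "codim (T ` L) (T ` M) = codim L M"
proof -
  note L = lagrangianD[OF assms(2)] and M = lagrangianD[OF assms(3)]
  have "T ` (L \<inter> M) = T ` L \<inter> T ` M"
    using symplectic_perturbation_inj[OF assms(1)] L(2) M(2) by (rule inj_on_image_Int)
  moreover have "dim (T ` (L \<inter> M)) = dim (L \<inter> M)"
    using L(1,2) M(1) by (intro symplectic_perturbation_dim[OF assms(1)]) (auto intro: subspace_inter)
  ultimately show ?thesis
    using symplectic_perturbation_dim[OF assms(1) L(1,2)] by (simp add: codim_def)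
qed

lemma openin_lagrangian_topology:
  "openin (lagrangian_topology V \<omega>) U \<longleftrightarrow>
     (\<exists>G. openin (grassmannian_topology (dim V div 2) V) G \<and> U = G \<inter> lagrangians V \<omega>)"
  unfolding lagrangian_topology_def openin_subtopology ..

lemma lagrangian_open_subset: "openin (lagrangian_topology V \<omega>) U \<Longrightarrow> U \<subseteq> lagrangians V \<omega>"
  by (auto simp: openin_lagrangian_topology)

lemma topspace_lagrangian_topology: "topspace (lagrangian_topology V \<omega>) = lagrangians V \<omega>"
proof -
  have "openin (frame_topology k V) {v \<in> frames k V. span (v ` {..<k}) \<in> grassmannian k V}" for k
  proof -
    have "{v \<in> frames k V. span (v ` {..<k}) \<in> grassmannian k V} = topspace (frame_topology k V)"
      using span_frame_in_grassmannian[OF subspace_V]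
      by (auto simp: frame_topology_def frames_def)
    then show ?thesis by (metis openin_topspace)
  qed
  then have "openin (grassmannian_topology k V) (grassmannian k V)" for k
    by (simp add: openin_grassmannian_topology)
  then have "grassmannian k V \<subseteq> topspace (grassmannian_topology k V)" for k
    by (rule openin_subset)
  then show ?thesis
    using lagrangians_subset_grassmannian by (auto simp: lagrangian_topology_def)
qed

lemma lagrangian_open_contains_close:
  assumes "openin (lagrangian_topology V \<omega>) U" "L \<in> U"
  obtains \<epsilon> where "\<epsilon> > 0"
    "\<And>M. M \<in> lagrangians V \<omega> \<Longrightarrow> (\<And>w. w \<in> L \<Longrightarrow> \<exists>v\<in>M. norm (v - w) \<le> \<epsilon> * norm w) \<Longrightarrow> M \<in> U"
proof -
  obtain G where G: "openin (grassmannian_topology (dim V div 2) V) G" "U = G \<inter> lagrangians V \<omega>"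
    using assms(1) by (auto simp: openin_lagrangian_topology)
  obtain \<epsilon> where "\<epsilon> > 0" "\<And>M. M \<in> grassmannian (dim V div 2) V \<Longrightarrow>
      (\<And>w. w \<in> L \<Longrightarrow> \<exists>v\<in>M. norm (v - w) \<le> \<epsilon> * norm w) \<Longrightarrow> M \<in> G"
    using grassmannian_open_contains_close[OF G(1)] assms(2) G(2) by blast
  then show ?thesis using that G(2) lagrangians_subset_grassmannian by blast
qed

text \<open>Fix a Lagrangian complement \<open>H\<close> of \<open>L\<close>. A Lagrangian \<open>M\<close> close to \<open>L\<close> is still transverse
  to \<open>H\<close>, hence the graph of a map \<open>L \<rightarrow> H\<close>; the shear along \<open>H\<close> by this map takes \<open>L\<close> to \<open>M\<close>,
  and it is symplectic because \<open>L\<close>, \<open>M\<close> and \<open>H\<close> are all isotropic.\<close>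

lemma nearby_lagrangian_is_perturbation:
  assumes "L \<in> lagrangians V \<omega>" "\<epsilon> > 0"
  obtains O' where "openin (lagrangian_topology V \<omega>) O'" "L \<in> O'"
    "\<And>M. M \<in> O' \<Longrightarrow> \<exists>T. symplectic_perturbation \<epsilon> T \<and> T ` L = M"
proof -
  note L = lagrangianD[OF assms(1)]
  have "isotropic {0}" by (auto simp: isotropic_def V_closed zero_left)
  moreover have "{0} \<inter> L = {0}" using L(1) subspace_0 by auto
  ultimately obtain H where H: "H \<in> lagrangians V \<omega>" "H \<inter> L = {0}"
    using extend_isotropic_to_lagrangian[OF _ L(4)] by metis
  note H' = lagrangianD[OF H(1)]
  have complement: "\<exists>a\<in>A. \<exists>b\<in>H. x = a + b"
    if A: "A \<in> lagrangians V \<omega>" "A \<inter> H = {0}" and "x \<in> V" for A x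
  proof -
    note A' = lagrangianD[OF A(1)]
    let ?S = "{x + y | x y. x \<in> A \<and> y \<in> H}"
    have "dim ?S + dim (A \<inter> H) = dim A + dim H" by (rule dim_sums_Int[OF A'(1) H'(1)])
    then have "dim V \<le> dim ?S" using A(2) A'(5) H'(5) by simp
    moreover have "?S \<subseteq> V" using A'(2) H'(2) V_closed(2) by blast
    ultimately have "?S = V"
      using A'(1) H'(1) subspace_V by (intro subspace_dim_equal subspace_sums) auto
    then show ?thesis using \<open>x \<in> V\<close> by blast
  qed
  obtain P where P: "linear P" "\<And>a. a \<in> L \<Longrightarrow> P a = a" "\<And>b. b \<in> H \<Longrightarrow> P b = 0"
    using projection_along[OF L(1) H'(1)] H(2) by (metis Int_commute)
  have PV: "P x \<in> L" "x - P x \<in> H" if "x \<in> V" for x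
  proof -
    obtain a b where ab: "a \<in> L" "b \<in> H" "x = a + b"
      using complement[OF assms(1) _ \<open>x \<in> V\<close>] H(2) by (metis Int_commute)
    then have "P x = a" using P by (simp add: linear_add)
    then show "P x \<in> L" "x - P x \<in> H" using ab by auto
  qed
  define Q where "Q = (\<lambda>x. x - P x)"
  have Q: "linear Q" unfolding Q_def using P(1) by (intro linear_compose_sub linear_ident)
  obtain K where K: "K > 0" "\<And>x. norm (Q x) \<le> K * norm x" using linear_bounded_pos[OF Q] by blast
  obtain K' where K': "K' > 0" "\<And>x. norm (P x) \<le> K' * norm x" using linear_bounded_pos[OF P(1)] by blast
  \<comment> \<open>The first bound makes \<open>M\<close> transverse to \<open>H\<close>; the second is the size of the resulting shear,
    \<open>norm (Q u) \<le> K * \<eta> * norm u\<close> with \<open>norm u \<le> 2 * norm (P x) \<le> 2 * K' * norm x\<close>.\<close>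
  define \<eta> where "\<eta> = min (1 / (2 * K)) (\<epsilon> / (2 * K * K'))"
  have \<eta>: "\<eta> > 0" "K * \<eta> \<le> 1 / 2" "2 * K * \<eta> * K' \<le> \<epsilon>"
  proof -
    show "\<eta> > 0" using K(1) K'(1) assms(2) by (simp add: \<eta>_def)
    have "\<eta> \<le> 1 / (2 * K)" "\<eta> \<le> \<epsilon> / (2 * K * K')" by (auto simp: \<eta>_def)
    then show "K * \<eta> \<le> 1 / 2" "2 * K * \<eta> * K' \<le> \<epsilon>"
      using K(1) K'(1) by (auto simp: field_simps)
  qed
  obtain G where G: "openin (grassmannian_topology (dim V div 2) V) G" "L \<in> G"
    "\<And>M v. M \<in> G \<Longrightarrow> v \<in> M \<Longrightarrow> \<exists>w\<in>L. norm (v - w) \<le> \<eta> * norm v"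
    using grassmannian_close_neighbourhood[OF subspace_V, of L "dim V div 2" \<eta>] \<eta>(1) assms(1)
      lagrangians_subset_grassmannian by blast
  show ?thesis
  proof (rule that[of "G \<inter> lagrangians V \<omega>"])
    show "openin (lagrangian_topology V \<omega>) (G \<inter> lagrangians V \<omega>)"
      using G(1) by (auto simp: openin_lagrangian_topology)
    show "L \<in> G \<inter> lagrangians V \<omega>" using G(2) assms(1) by simp
    fix M assume M: "M \<in> G \<inter> lagrangians V \<omega>"
    then have M': "M \<in> lagrangians V \<omega>" by simp
    note M_lag = lagrangianD[OF M']
    have QM: "norm (Q u) \<le> K * \<eta> * norm u" if "u \<in> M" for u
    proof -
      obtain p where p: "p \<in> L" "norm (u - p) \<le> \<eta> * norm u" using G(3) M \<open>u \<in> M\<close> by blast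
      have "Q u = Q (u - p)" using P p(1) by (simp add: Q_def linear_diff)
      also have "norm \<dots> \<le> K * (\<eta> * norm u)"
        using K(2)[of "u - p"] mult_left_mono[OF p(2) less_imp_le[OF K(1)]] by linarith
      finally show ?thesis by (simp add: mult.assoc)
    qed
    have Q2: "norm (Q u) \<le> norm u / 2" if "u \<in> M" for u
      using QM[OF that] mult_right_mono[OF \<eta>(2), of "norm u"] by simp
    have MH: "M \<inter> H = {0}"
    proof -
      have "u = 0" if "u \<in> M" "u \<in> H" for u using Q2[OF that(1)] P(3)[OF that(2)] by (simp add: Q_def)
      then show ?thesis using M_lag(1) H'(1) subspace_0 by auto
    qed
    obtain R where R: "linear R" "\<And>a. a \<in> M \<Longrightarrow> R a = a" "\<And>b. b \<in> H \<Longrightarrow> R b = 0"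
      using projection_along[OF M_lag(1) H'(1) MH] by blast
    have RV: "R x \<in> M" "x - R x \<in> H" if "x \<in> V" for x
    proof -
      obtain a b where ab: "a \<in> M" "b \<in> H" "x = a + b" using complement[OF M' MH \<open>x \<in> V\<close>] by blast
      then have "R x = a" using R by (simp add: linear_add)
      then show "R x \<in> M" "x - R x \<in> H" using ab by auto
    qed
    \<comment> \<open>On \<open>x = a + b\<close> with \<open>a \<in> L\<close> and \<open>b \<in> H\<close>, this replaces \<open>a\<close> by the point of \<open>M\<close> in \<open>a + H\<close>.\<close>
    define T where "T = (\<lambda>x. R (P x) + Q x)"
    have "symplectic_perturbation \<epsilon> T"
      unfolding symplectic_perturbation_def
    proof (intro conjI ballI)
      show "linear T"
        unfolding T_def using linear_compose[OF P(1) R(1)] Q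
        by (intro linear_compose_add) (auto simp: o_def)
      have mem: "P x \<in> L" "R (P x) \<in> M" "Q x \<in> H" "P x - R (P x) \<in> H"
        and memV: "P x \<in> V" "R (P x) \<in> V" "Q x \<in> V" if "x \<in> V" for x
      proof -
        show 1: "P x \<in> L" "Q x \<in> H" using PV[OF that] by (auto simp: Q_def)
        show 2: "P x \<in> V" using 1(1) L(2) by (rule subsetD[rotated])
        show 3: "R (P x) \<in> M" "P x - R (P x) \<in> H" using RV[OF 2] by auto
        show "R (P x) \<in> V" using 3(1) M_lag(2) by (rule subsetD[rotated])
        show "Q x \<in> V" using 1(2) H'(2) by (rule subsetD[rotated])
      qed
      show "T ` V \<subseteq> V"
        using memV V_closed(2) by (auto simp: T_def)
      show "norm (T x - x) \<le> \<epsilon> * norm x" if "x \<in> V" for x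
      proof -
        define u where "u = R (P x)"
        have u: "u \<in> M" "P x - u \<in> H" using mem[OF that] by (auto simp: u_def)
        have "P u = P x" using P(1,2) P(3)[OF u(2)] PV(1)[OF that] by (simp add: linear_diff)
        then have Qu: "T x - x = Q u" by (simp add: T_def Q_def u_def)
        have "norm u \<le> norm (P x) + norm (Q u)"
          using \<open>P u = P x\<close> norm_triangle_ineq[of "P x" "Q u"] by (simp add: Q_def)
        then have "norm u \<le> 2 * (K' * norm x)" using Q2[OF u(1)] K'(2)[of x] by simp
        then have "K * \<eta> * norm u \<le> K * \<eta> * (2 * (K' * norm x))"
          using K(1) \<eta>(1) by (intro mult_left_mono) auto
        then have "norm (Q u) \<le> K * \<eta> * (2 * (K' * norm x))"
          using QM[OF u(1)] by linarith
        also have "\<dots> = (2 * K * \<eta> * K') * norm x" by simp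
        also have "\<dots> \<le> \<epsilon> * norm x" using \<eta>(3) by (intro mult_right_mono) auto
        finally show ?thesis by (simp add: Qu)
      qed
      show "\<omega> (T x) (T y) = \<omega> x y" if "x \<in> V" "y \<in> V" for x y
      proof -
        let ?a = "P x" and ?a' = "P y" and ?u = "R (P x)" and ?u' = "R (P y)"
          and ?b = "Q x" and ?b' = "Q y"
        note mem = mem[OF that(1)] mem[OF that(2)] and memV = memV[OF that(1)] memV[OF that(2)]
        have "\<omega> (?a - ?u) ?b' = 0" "\<omega> ?b (?a' - ?u') = 0" using mem by (auto intro: H'(6))
        then have cross: "\<omega> ?u ?b' = \<omega> ?a ?b'" "\<omega> ?b ?u' = \<omega> ?b ?a'"
          using memV by (simp_all add: diff_left diff_right)
        have zero: "\<omega> ?b ?b' = 0" "\<omega> ?u ?u' = 0" "\<omega> ?a ?a' = 0"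
          using mem by (auto intro: H'(6) M_lag(6) L(6))
        have "\<omega> (?u + ?b) (?u' + ?b') = \<omega> ?u ?b' + \<omega> ?b ?u'"
          using memV zero by (simp add: add_left add_right V_closed(2))
        also have "\<dots> = \<omega> (?a + ?b) (?a' + ?b')"
          using memV zero cross by (simp add: add_left add_right V_closed(2))
        finally show ?thesis by (simp add: T_def Q_def)
      qed
    qed
    moreover have "T ` L = M"
    proof (intro equalityI subsetI)
      fix y assume "y \<in> T ` L"
      then show "y \<in> M" using P(2) RV(1) L(2) by (auto simp: T_def Q_def)
    next
      fix u assume u: "u \<in> M"
      then have uV: "u \<in> V" using M_lag(2) by auto
      have "R (P u) = u" using R(1) R(2)[OF u] R(3)[OF PV(2)[OF uV]] by (simp add: linear_diff)
      then have "u = T (P u)" using P(2) PV(1)[OF uV] by (simp add: T_def Q_def)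
      then show "u \<in> T ` L" using PV(1)[OF uV] by blast
    qed
    ultimately show "\<exists>T. symplectic_perturbation \<epsilon> T \<and> T ` L = M" by blast
  qed
qed

text \<open>The perturbation that takes \<open>L\<close> to \<open>M\<close> also moves \<open>K\<close>, staying in \<open>U\<close> and preserving codimension.\<close>

lemma nearby_lagrangian_within_codim:
  assumes "openin (lagrangian_topology V \<omega>) U" "K \<in> U" "L \<in> lagrangians V \<omega>"
  obtains O' where "openin (lagrangian_topology V \<omega>) O'" "L \<in> O'"
    "\<And>M. M \<in> O' \<Longrightarrow> \<exists>K'\<in>U. codim K' M \<le> codim K L"
proof -
  have K: "K \<in> lagrangians V \<omega>" using lagrangian_open_subset assms(1,2) by blast
  obtain \<epsilon> where \<epsilon>: "\<epsilon> > 0" "\<And>M. M \<in> lagrangians V \<omega> \<Longrightarrow>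
      (\<And>w. w \<in> K \<Longrightarrow> \<exists>v\<in>M. norm (v - w) \<le> \<epsilon> * norm w) \<Longrightarrow> M \<in> U"
    using lagrangian_open_contains_close[OF assms(1,2)] by blast
  obtain O' where O': "openin (lagrangian_topology V \<omega>) O'" "L \<in> O'"
    "\<And>M. M \<in> O' \<Longrightarrow> \<exists>T. symplectic_perturbation \<epsilon> T \<and> T ` L = M"
    using nearby_lagrangian_is_perturbation[OF assms(3) \<epsilon>(1)] by blast
  show ?thesis
  proof (rule that[OF O'(1,2)])
    fix M assume "M \<in> O'"
    then obtain T where T: "symplectic_perturbation \<epsilon> T" "T ` L = M" using O'(3) by blast
    have "T ` K \<in> U"
      using lagrangianD(2)[OF K] symplectic_perturbationD(4)[OF T(1)]
      by (intro \<epsilon>(2) symplectic_perturbation_lagrangian[OF T(1) K]) auto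
    then show "\<exists>K'\<in>U. codim K' M \<le> codim K L"
      using symplectic_perturbation_codim[OF T(1) K assms(3)] T(2) by (intro bexI[of _ "T ` K"]) auto
  qed
qed

end

section \<open>Coisotropic reduction\<close>

text \<open>The reduced space \<open>C / orth C\<close> is given by a model \<open>W\<close> with a projection \<open>p\<close> of \<open>C\<close> onto it
  that is compatible with the forms; nondegeneracy of \<open>W\<close> makes \<open>orth C\<close> the kernel of \<open>p\<close> on \<open>C\<close>.\<close>

locale symplectic_reduction = V: symplectic V \<omega> + W: symplectic W \<eta>
  for V :: "'v::euclidean_space set" and \<omega> and W :: "'w::euclidean_space set" and \<eta> +
  fixes C :: "'v set" and p :: "'v \<Rightarrow> 'w"
  assumes subspace_C: "subspace C" and C_subset: "C \<subseteq> V" and coisotropic: "V.orth C \<subseteq> C"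
    and linear_p: "linear p" and image_p: "p ` C = W"
    and form_p: "x \<in> C \<Longrightarrow> y \<in> C \<Longrightarrow> \<eta> (p x) (p y) = \<omega> x y"
begin

abbreviation I :: "'v set" where "I \<equiv> V.orth C"

abbreviation red :: "'v set \<Rightarrow> 'w set" where "red L \<equiv> p ` (L \<inter> C)"

lemma subspace_I: "subspace I"
  by (rule V.subspace_orth[OF C_subset])

lemma kernel: "x \<in> I \<longleftrightarrow> x \<in> C \<and> p x = 0"
proof
  assume x: "x \<in> I"
  then have xC: "x \<in> C" using coisotropic by auto
  have "p x = 0"
  proof (rule W.nondegenerate)
    show "p x \<in> W" using xC image_p by auto
    fix w assume "w \<in> W"
    then obtain y where "y \<in> C" "w = p y" using image_p by auto
    then show "\<eta> (p x) w = 0" using form_p[OF xC] x by (simp add: symplectic_orthogonal_def)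
  qed
  then show "x \<in> C \<and> p x = 0" using xC by simp
next
  assume x: "x \<in> C \<and> p x = 0"
  have "\<omega> x y = 0" if "y \<in> C" for y
  proof -
    have "p y \<in> W" using that image_p by auto
    then show ?thesis using form_p[of x y] that x W.zero_left by simp
  qed
  then show "x \<in> I" using x C_subset by (auto simp: symplectic_orthogonal_def)
qed

lemma isotropic_I: "V.isotropic I"
proof -
  have "I \<subseteq> V.orth I" using coisotropic V.orth_orth[OF subspace_C C_subset] by simp
  then show ?thesis using subspace_I V.orth_subset[of C] by (simp add: V.isotropic_iff)
qed

lemma dim_image_p:
  assumes "subspace A" "A \<subseteq> C"
  shows "dim (p ` A) + dim (A \<inter> I) = dim A"
proof -
  have "A \<inter> I = {x \<in> A. p x = 0}" using assms(2) kernel by blast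
  then show ?thesis using dim_linear_image_kernel[OF linear_p assms(1)] by simp
qed

lemma dim_C: "dim I + dim C = dim V"
  by (rule V.dim_orth[OF subspace_C C_subset])

lemma dim_W: "dim W + 2 * dim I = dim V"
proof -
  have "dim W + dim (C \<inter> I) = dim C"
    using dim_image_p[OF subspace_C order_refl] image_p by simp
  moreover have "C \<inter> I = I" using coisotropic by auto
  ultimately show ?thesis using dim_C by simp
qed

text \<open>Since \<open>L \<inter> C\<close> is the orthogonal of \<open>L + I\<close>, the position of \<open>L\<close> relative to \<open>C\<close> is determined
  by its position relative to \<open>I\<close>.\<close>

lemma dim_lagrangian_Int_C:
  assumes "L \<in> lagrangians V \<omega>"
  shows "dim (L \<inter> C) + dim I = dim L + dim (L \<inter> I)"
proof -
  note L = V.lagrangianD[OF assms]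
  let ?S = "{x + y | x y. x \<in> L \<and> y \<in> I}"
  have "V.orth ?S = L \<inter> C"
    using V.orth_sums[OF L(1) subspace_I L(2) V.orth_subset] L(3)
      V.orth_orth[OF subspace_C C_subset] by simp
  moreover have "subspace ?S" by (rule subspace_sums[OF L(1) subspace_I])
  moreover have "?S \<subseteq> V" using L(2) V.orth_subset[of C] V.V_closed(2) by blast
  ultimately have "dim (L \<inter> C) + dim ?S = dim V" using V.dim_orth[of ?S] by simp
  moreover have "dim ?S + dim (L \<inter> I) = dim L + dim I" by (rule dim_sums_Int[OF L(1) subspace_I])
  ultimately show ?thesis using L(5) by simp
qed

lemma dim_red:
  assumes "L \<in> lagrangians V \<omega>"
  shows "dim (red L) + dim I = dim L"
proof -
  have "subspace (L \<inter> C)" using V.lagrangianD(1)[OF assms] subspace_C by (rule subspace_inter)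
  then have "dim (red L) + dim (L \<inter> C \<inter> I) = dim (L \<inter> C)" by (rule dim_image_p) simp
  moreover have "L \<inter> C \<inter> I = L \<inter> I" using coisotropic by auto
  ultimately show ?thesis using dim_lagrangian_Int_C[OF assms] by simp
qed

lemma red_lagrangian:
  assumes "L \<in> lagrangians V \<omega>"
  shows "red L \<in> lagrangians W \<eta>"
proof (rule W.lagrangianI)
  note L = V.lagrangianD[OF assms]
  show "W.isotropic (red L)"
    unfolding W.isotropic_def
  proof (intro conjI ballI)
    show "subspace (red L)"
      using L(1) subspace_C by (intro linear_subspace_image[OF linear_p] subspace_inter)
    show "red L \<subseteq> W" using image_p by auto
    show "\<eta> x y = 0" if "x \<in> red L" "y \<in> red L" for x y
      using that L(6) by (auto simp: form_p)
  qed
  show "dim W \<le> 2 * dim (red L)" using dim_red[OF assms] dim_W L(5) by simp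
qed

text \<open>Reduction increases the codimension by no more than the loss \<open>dim (L \<inter> I) - dim (M \<inter> I)\<close>:
  \<open>L \<inter> M\<close> has codimension \<open>codim L M\<close> in \<open>M\<close>, so \<open>L \<inter> M \<inter> C\<close> has at most that codimension in
  \<open>M \<inter> C\<close>; its image lies in the intersection of the two reductions, and \<open>p\<close> loses at most
  \<open>dim (L \<inter> I)\<close> dimensions on it.\<close>

lemma codim_red:
  assumes "L \<in> lagrangians V \<omega>" "M \<in> lagrangians V \<omega>"
  shows "codim (red L) (red M) + dim (M \<inter> I) \<le> codim L M + dim (L \<inter> I)"
proof -
  note L = V.lagrangianD[OF assms(1)] and M = V.lagrangianD[OF assms(2)]
  have sub: "subspace (L \<inter> M \<inter> C)" "subspace (L \<inter> M)" "subspace (M \<inter> C)"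
    using L(1) M(1) subspace_C by (simp_all add: subspace_inter)
  let ?S = "{x + y | x y. x \<in> L \<inter> M \<and> y \<in> M \<inter> C}"
  have "dim ?S + dim ((L \<inter> M) \<inter> (M \<inter> C)) = dim (L \<inter> M) + dim (M \<inter> C)"
    by (rule dim_sums_Int[OF sub(2,3)])
  moreover have "(L \<inter> M) \<inter> (M \<inter> C) = L \<inter> M \<inter> C" by auto
  moreover have "dim ?S \<le> dim L"
  proof -
    have "dim ?S \<le> dim M" using M(1) by (intro dim_subset) (auto intro: subspace_add)
    then show ?thesis using L(5) M(5) by simp
  qed
  ultimately have meet: "dim (L \<inter> M) + dim (M \<inter> C) \<le> dim L + dim (L \<inter> M \<inter> C)" by simp
  have "dim (p ` (L \<inter> M \<inter> C)) + dim (L \<inter> M \<inter> C \<inter> I) = dim (L \<inter> M \<inter> C)"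
    by (rule dim_image_p[OF sub(1)]) simp
  moreover have "dim (p ` (L \<inter> M \<inter> C)) \<le> dim (red L \<inter> red M)" by (intro dim_subset) auto
  moreover have "dim (L \<inter> M \<inter> C \<inter> I) \<le> dim (L \<inter> I)" by (intro dim_subset) auto
  ultimately have image: "dim (L \<inter> M \<inter> C) \<le> dim (red L \<inter> red M) + dim (L \<inter> I)" by linarith
  have "codim L M + dim (L \<inter> M) = dim L"
    "codim (red L) (red M) + dim (red L \<inter> red M) = dim (red L)"
    by (simp_all add: codim_def dim_subset)
  moreover have "dim L = dim M" using L(5) M(5) by simp
  ultimately show ?thesis
    using meet image dim_lagrangian_Int_C[OF assms(2)] dim_red[OF assms(1)] by linarith
qed

text \<open>If \<open>L \<inter> I = 0\<close> then \<open>L\<close> is transverse to \<open>C\<close>, by orthogonality. A complement \<open>D\<close> of \<open>L \<inter> C\<close>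
  in \<open>L\<close> is then a complement of \<open>C\<close> in \<open>V\<close>, and for \<open>l \<in> L \<inter> C\<close> the vector \<open>T l\<close> can be pushed back
  into \<open>C\<close> by a small correction \<open>T d\<close> with \<open>d \<in> D\<close>: modulo \<open>C\<close>, the map \<open>T\<close> is close to the identity of \<open>D\<close>.
  Moreover \<open>p\<close> is injective on \<open>L \<inter> C\<close>, so \<open>l\<close> is bounded by \<open>p l\<close>.\<close>

lemma red_perturbation_transverse:
  assumes L: "L \<in> lagrangians V \<omega>" and LI: "L \<inter> I = {0}"
    and O': "openin (lagrangian_topology W \<eta>) O'" "red L \<in> O'"
  obtains \<delta> where "\<delta> > 0"
    "\<And>T. V.symplectic_perturbation \<delta> T \<Longrightarrow> T ` L \<inter> I = {0} \<and> red (T ` L) \<in> O'"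
proof -
  note L' = V.lagrangianD[OF L]
  have subLC: "subspace (L \<inter> C)" using L'(1) subspace_C by (rule subspace_inter)
  obtain \<epsilon> where \<epsilon>: "\<epsilon> > 0" "\<And>M. M \<in> lagrangians W \<eta> \<Longrightarrow>
      (\<And>w. w \<in> red L \<Longrightarrow> \<exists>v\<in>M. norm (v - w) \<le> \<epsilon> * norm w) \<Longrightarrow> M \<in> O'"
    using W.lagrangian_open_contains_close[OF O'] by blast
  obtain D where D: "subspace D" "D \<subseteq> L" "L \<inter> C \<inter> D = {0}" "dim D + dim (L \<inter> C) = dim L"
    by (rule complement_in_subspace[OF subLC L'(1) Int_lower1])
  have DC: "D \<inter> C = {0}" using D(2,3) by auto
  have DV: "D \<subseteq> V" using D(2) L'(2) by auto
  have "{x + y | x y. x \<in> D \<and> y \<in> C} = V"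
  proof (rule subspace_dim_equal)
    have "dim {x + y | x y. x \<in> D \<and> y \<in> C} + dim (D \<inter> C) = dim D + dim C"
      by (rule dim_sums_Int[OF D(1) subspace_C])
    then show "dim V \<le> dim {x + y | x y. x \<in> D \<and> y \<in> C}"
      using D(4) DC dim_lagrangian_Int_C[OF L] LI dim_C by simp
    show "{x + y | x y. x \<in> D \<and> y \<in> C} \<subseteq> V" using DV C_subset V.V_closed(2) by blast
  qed (use subspace_sums[OF D(1) subspace_C] V.subspace_V in auto)
  then have decomp: "\<exists>d\<in>D. \<exists>c\<in>C. x = d + c" if "x \<in> V" for x using that by blast
  obtain s where s: "linear s" "\<And>d. d \<in> D \<Longrightarrow> s d = d" "\<And>c. c \<in> C \<Longrightarrow> s c = 0"
    using projection_along[OF D(1) subspace_C DC] by blast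
  have sV: "s x \<in> D" "x - s x \<in> C" if "x \<in> V" for x
  proof -
    obtain d c where dc: "d \<in> D" "c \<in> C" "x = d + c" using decomp[OF \<open>x \<in> V\<close>] by blast
    then have "s x = d" using s by (simp add: linear_add)
    then show "s x \<in> D" "x - s x \<in> C" using dc by auto
  qed
  obtain \<phi> where \<phi>: "linear \<phi>" "\<And>l. l \<in> L \<Longrightarrow> \<phi> l = l" "\<And>u. u \<in> I \<Longrightarrow> \<phi> u = 0"
    using projection_along[OF L'(1) subspace_I LI] by blast
  have "inj_on p (L \<inter> C)"
  proof -
    have "x = 0" if "x \<in> L \<inter> C" "p x = 0" for x
      using that kernel[of x] LI by auto
    then show ?thesis using subLC linear_p by (subst linear_injective_on_subspace_0) auto
  qed
  then obtain g where g: "linear g" "\<And>l. l \<in> L \<inter> C \<Longrightarrow> g (p l) = l"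
    using linear_exists_left_inverse_on[OF linear_p subLC] by blast
  obtain Ks where Ks: "Ks > 0" "\<And>x. norm (s x) \<le> Ks * norm x" using linear_bounded_pos[OF s(1)] by blast
  obtain Kf where Kf: "Kf > 0" "\<And>x. norm (\<phi> x) \<le> Kf * norm x" using linear_bounded_pos[OF \<phi>(1)] by blast
  obtain Kg where Kg: "Kg > 0" "\<And>x. norm (g x) \<le> Kg * norm x" using linear_bounded_pos[OF g(1)] by blast
  obtain Kp where Kp: "Kp > 0" "\<And>x. norm (p x) \<le> Kp * norm x" using linear_bounded_pos[OF linear_p] by blast
  \<comment> \<open>In order: \<open>T\<close> at most doubles norms; \<open>s \<circ> T\<close> is onto \<open>D\<close>; \<open>T L\<close> misses \<open>I\<close>; and the final
    estimate, whose factor \<open>1 + 4 * Ks\<close> comes from \<open>norm (T d) \<le> 4 * (Ks * \<delta> * norm l)\<close>.\<close>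
  define \<delta> where "\<delta> = min (min 1 (1 / (2 * Ks))) (min (1 / (2 * Kf)) (\<epsilon> / (Kp * Kg * (1 + 4 * Ks))))"
  have \<delta>: "\<delta> > 0" "\<delta> \<le> 1" "Ks * \<delta> \<le> 1 / 2" "Kf * \<delta> \<le> 1 / 2" "Kp * Kg * (1 + 4 * Ks) * \<delta> \<le> \<epsilon>"
  proof -
    have pos: "Kp * Kg * (1 + 4 * Ks) > 0" using Ks(1) Kg(1) Kp(1) by simp
    then show "\<delta> > 0" using Ks(1) Kf(1) \<epsilon>(1) by (simp add: \<delta>_def)
    have *: "\<delta> \<le> 1" "\<delta> \<le> 1 / (2 * Ks)" "\<delta> \<le> 1 / (2 * Kf)" "\<delta> \<le> \<epsilon> / (Kp * Kg * (1 + 4 * Ks))"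
      by (auto simp: \<delta>_def)
    then show "\<delta> \<le> 1" "Ks * \<delta> \<le> 1 / 2" "Kf * \<delta> \<le> 1 / 2"
      using Ks(1) Kf(1) by (auto simp: field_simps)
    show "Kp * Kg * (1 + 4 * Ks) * \<delta> \<le> \<epsilon>"
      using *(4) unfolding pos_le_divide_eq[OF pos] by (simp only: mult.commute)
  qed
  show ?thesis
  proof (rule that[OF \<delta>(1)], intro conjI)
    fix T assume T0: "V.symplectic_perturbation \<delta> T"
    note T = V.symplectic_perturbationD[OF T0]
    have "u = 0" if u: "u \<in> T ` L" "u \<in> I" for u
    proof -
      obtain l where l: "l \<in> L" "u = T l" using u(1) by blast
      have lV: "l \<in> V" using l(1) L'(2) by auto
      have "norm l = norm (\<phi> (T l - l))"
        using \<phi>(1) \<phi>(2)[OF l(1)] \<phi>(3)[OF u(2)] l(2) by (simp add: linear_diff)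
      also have "\<dots> \<le> Kf * (\<delta> * norm l)"
        using Kf(2)[of "T l - l"] mult_left_mono[OF T(4)[OF lV] less_imp_le[OF Kf(1)]] by linarith
      also have "\<dots> \<le> 1 / 2 * norm l"
        using mult_right_mono[OF \<delta>(4), of "norm l"] by (simp add: mult.assoc)
      finally show ?thesis using l(2) linear_0[OF T(1)] by simp
    qed
    moreover have "0 \<in> T ` L" "0 \<in> I"
      using linear_0[OF T(1)] subspace_0[OF L'(1)] subspace_0[OF subspace_I] by (auto intro: rev_image_eqI)
    ultimately show "T ` L \<inter> I = {0}" by auto
    show "red (T ` L) \<in> O'"
    proof (rule \<epsilon>(2))
      show "red (T ` L) \<in> lagrangians W \<eta>"
        by (rule red_lagrangian[OF V.symplectic_perturbation_lagrangian[OF T0 L]])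
      fix w assume "w \<in> red L"
      then obtain l where l: "l \<in> L" "l \<in> C" "w = p l" by blast
      have lV: "l \<in> V" using l(1) L'(2) by auto
      have nl: "norm l \<le> Kg * norm w" using Kg(2)[of w] g(2)[of l] l by simp
      have sT: "norm (s (T x) - s x) \<le> Ks * \<delta> * norm x" if "x \<in> V" for x
        using Ks(2)[of "T x - x"] mult_left_mono[OF T(4)[OF that] less_imp_le[OF Ks(1)]] s(1)
        by (simp add: linear_diff mult.assoc)
      have half: "Ks * \<delta> * norm x \<le> 1 / 2 * norm x" for x :: 'v
        using \<delta>(3) by (intro mult_right_mono) auto
      have "(s \<circ> T) ` D = D"
      proof (rule linear_near_identity_surj)
        show "linear (s \<circ> T)" by (rule linear_compose[OF T(1) s(1)])
        show "(s \<circ> T) ` D \<subseteq> D" using DV T(2) sV(1) by auto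
        show "norm ((s \<circ> T) d - d) \<le> 1 / 2 * norm d" if "d \<in> D" for d
          using sT[of d] half[of d] that DV s(2)[OF that] by auto
      qed (use D(1) in auto)
      moreover have "- s (T l) \<in> D" by (rule subspace_neg[OF D(1) sV(1)[OF T(2)[OF lV]]])
      ultimately have "- s (T l) \<in> (s \<circ> T) ` D" by simp
      then obtain d where d: "d \<in> D" "s (T d) = - s (T l)" by auto
      have dV: "d \<in> V" using d(1) DV by auto
      have "norm d \<le> norm (s (T d)) + norm (s (T d) - d)"
        using norm_triangle_ineq[of "s (T d)" "d - s (T d)"] by (simp add: norm_minus_commute)
      also have "\<dots> \<le> Ks * \<delta> * norm l + 1 / 2 * norm d"
        using sT[OF lV] s(3)[OF l(2)] sT[OF dV] half[of d] s(2)[OF d(1)] d(2) by simp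
      finally have nd: "norm d \<le> 2 * (Ks * \<delta> * norm l)" by simp
      define v where "v = T (l + d)"
      have v: "v \<in> T ` L" using l(1) d(1) D(2) L'(1) by (auto simp: v_def intro: subspace_add)
      have "s v = 0" using d(2) s(1) T(1) by (simp add: v_def linear_add)
      moreover have "v \<in> V" using T(2)[OF V.V_closed(2)[OF lV dV]] by (simp add: v_def)
      ultimately have vC: "v \<in> C" using sV(2)[of v] by simp
      have "norm (T d) \<le> norm d + norm (T d - d)"
        using norm_triangle_ineq[of d "T d - d"] by simp
      also have "\<dots> \<le> norm d + 1 * norm d"
        using T(4)[OF dV] mult_right_mono[OF \<delta>(2), of "norm d"] by simp
      finally have nTd: "norm (T d) \<le> 4 * (Ks * \<delta> * norm l)" using nd by simp
      have "norm (v - l) = norm ((T l - l) + T d)" using T(1) by (simp add: v_def linear_add algebra_simps)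
      also have "\<dots> \<le> norm (T l - l) + norm (T d)" by (rule norm_triangle_ineq)
      also have "\<dots> \<le> \<delta> * norm l + 4 * (Ks * \<delta> * norm l)" using T(4)[OF lV] nTd by simp
      also have "\<dots> = (1 + 4 * Ks) * \<delta> * norm l" by (simp add: algebra_simps)
      also have "\<dots> \<le> (1 + 4 * Ks) * \<delta> * (Kg * norm w)"
        using nl \<delta>(1) Ks(1) by (intro mult_left_mono) auto
      finally have "Kp * norm (v - l) \<le> Kp * ((1 + 4 * Ks) * \<delta> * (Kg * norm w))"
        using Kp(1) by (intro mult_left_mono) auto
      then have "norm (p v - w) \<le> (Kp * Kg * (1 + 4 * Ks) * \<delta>) * norm w"
        using Kp(2)[of "v - l"] linear_p l(3) by (simp add: linear_diff mult_ac)
      also have "\<dots> \<le> \<epsilon> * norm w" using \<delta>(5) by (intro mult_right_mono) auto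
      finally show "\<exists>v\<in>red (T ` L). norm (v - w) \<le> \<epsilon> * norm w" using v vC by blast
    qed
  qed
qed

text \<open>Extending a complement \<open>K\<close> of \<open>L \<inter> I\<close> in \<open>L\<close> to a Lagrangian \<open>L1\<close> that misses \<open>I\<close> gives
  \<open>codim L1 L \<le> dim (L \<inter> I)\<close>. There is no room left in \<open>codim_red\<close>, so \<open>L1\<close> and \<open>L\<close> have the same
  reduction, and the transverse case applies to \<open>L1\<close>.\<close>

lemma red_perturbation:
  assumes L: "L \<in> lagrangians V \<omega>"
    and O': "openin (lagrangian_topology W \<eta>) O'" "red L \<in> O'"
  obtains \<delta> where "\<delta> > 0"
    "\<And>T. V.symplectic_perturbation \<delta> T \<Longrightarrow>
       \<exists>M\<in>O'. codim M (red (T ` L)) + dim (T ` L \<inter> I) \<le> dim (L \<inter> I)"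
proof -
  note L' = V.lagrangianD[OF L]
  have LI: "subspace (L \<inter> I)" using L'(1) subspace_I by (rule subspace_inter)
  obtain K where K: "subspace K" "K \<subseteq> L" "L \<inter> I \<inter> K = {0}" "dim K + dim (L \<inter> I) = dim L"
    by (rule complement_in_subspace[OF LI L'(1) Int_lower1])
  have "V.isotropic K"
    unfolding V.isotropic_def using K(1,2) L'(2) by (auto intro: L'(6))
  moreover have "K \<inter> I = {0}" using K(2,3) by auto
  ultimately obtain L1 where L1: "L1 \<in> lagrangians V \<omega>" "K \<subseteq> L1" "L1 \<inter> I = {0}"
    using V.extend_isotropic_to_lagrangian[OF _ isotropic_I, of K] by blast
  have "dim K \<le> dim (L1 \<inter> L)" using K(2) L1(2) by (intro dim_subset) auto
  then have c: "codim L1 L \<le> dim (L \<inter> I)"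
    using K(4) V.lagrangianD(5)[OF L1(1)] L'(5) by (simp add: codim_def)
  have "codim (red L1) (red L) + dim (L \<inter> I) \<le> dim (L \<inter> I)"
    using codim_red[OF L1(1) L] c L1(3) by simp
  then have "codim (red L1) (red L) = 0" by simp
  note red1 = W.lagrangianD(1)[OF red_lagrangian[OF L1(1)]]
    and red2 = W.lagrangianD(1)[OF red_lagrangian[OF L]]
  have dims: "dim (red L1) = dim (red L)"
    using W.lagrangianD(5)[OF red_lagrangian[OF L1(1)]] W.lagrangianD(5)[OF red_lagrangian[OF L]] by simp
  have "red L1 \<inter> red L = red L1"
    using \<open>codim (red L1) (red L) = 0\<close>
    by (intro subspace_dim_equal subspace_inter red1 red2) (simp_all add: codim_def)
  then have "red L1 \<subseteq> red L" by (simp only: inf.absorb_iff1)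
  then have "red L1 = red L" using dims by (intro subspace_dim_equal red1 red2) simp_all
  then have "red L1 \<in> O'" using O'(2) by simp
  then obtain \<delta> where \<delta>: "\<delta> > 0"
    "\<And>T. V.symplectic_perturbation \<delta> T \<Longrightarrow> T ` L1 \<inter> I = {0} \<and> red (T ` L1) \<in> O'"
    using red_perturbation_transverse[OF L1(1,3) O'(1)] by blast
  show ?thesis
  proof (rule that[OF \<delta>(1)])
    fix T assume T: "V.symplectic_perturbation \<delta> T"
    have lag: "T ` L1 \<in> lagrangians V \<omega>" "T ` L \<in> lagrangians V \<omega>"
      using V.symplectic_perturbation_lagrangian[OF T] L1(1) L by auto
    have "codim (red (T ` L1)) (red (T ` L)) + dim (T ` L \<inter> I) \<le> codim (T ` L1) (T ` L) + dim (T ` L1 \<inter> I)"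
      by (rule codim_red[OF lag])
    also have "\<dots> \<le> dim (L \<inter> I)"
      using V.symplectic_perturbation_codim[OF T L1(1) L] c \<delta>(2)[OF T] by simp
    finally show "\<exists>M\<in>O'. codim M (red (T ` L)) + dim (T ` L \<inter> I) \<le> dim (L \<inter> I)"
      using \<delta>(2)[OF T] by blast
  qed
qed

end

section \<open>Composition as a reduction of products\<close>

lemma symplectic_space_opp:
  assumes "symplectic_space V \<omega>"
  shows "symplectic_space V (opp_form \<omega>)"
proof -
  interpret symplectic V \<omega> by (rule symplectic.intro[OF assms])
  show ?thesis
    unfolding symplectic_space_def opp_form_def
  proof (intro conjI ballI allI impI)
    show "- \<omega> x y = - (- \<omega> y x)" if "x \<in> V" "y \<in> V" for x y using skew[OF that] by simp
    show "x = 0" if "x \<in> V" "\<forall>y\<in>V. - \<omega> x y = 0" for x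
      using that by (intro nondegenerate) auto
  qed (simp_all add: subspace_V add_left scale_left)
qed

lemma symplectic_space_prod:
  fixes V :: "'a::euclidean_space set" and W :: "'b::euclidean_space set"
  assumes "symplectic_space V \<omega>" "symplectic_space W \<eta>"
  shows "symplectic_space (V \<times> W) (prod_form \<omega> \<eta>)"
proof -
  interpret V: symplectic V \<omega> by (rule symplectic.intro[OF assms(1)])
  interpret W: symplectic W \<eta> by (rule symplectic.intro[OF assms(2)])
  show ?thesis
    unfolding symplectic_space_def
  proof (intro conjI ballI allI impI)
    show "subspace (V \<times> W)" by (rule subspace_Times[OF V.subspace_V W.subspace_V])
    show "prod_form \<omega> \<eta> x y = - prod_form \<omega> \<eta> y x" if "x \<in> V \<times> W" "y \<in> V \<times> W" for x y
    proof -
      have "\<omega> (fst x) (fst y) = - \<omega> (fst y) (fst x)" "\<eta> (snd x) (snd y) = - \<eta> (snd y) (snd x)"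
        using that by (auto intro: V.skew W.skew)
      then show ?thesis by (simp add: prod_form_def case_prod_unfold)
    qed
    show "x = 0" if x: "x \<in> V \<times> W" and 0: "\<forall>y\<in>V \<times> W. prod_form \<omega> \<eta> x y = 0" for x
    proof -
      have xVW: "fst x \<in> V" "snd x \<in> W" using x by auto
      have "fst x = 0"
      proof (rule V.nondegenerate[OF xVW(1)])
        fix v assume "v \<in> V"
        then show "\<omega> (fst x) v = 0"
          using 0[rule_format, of "(v, 0)"] W.V_closed(1) W.zero_right[OF xVW(2)]
          by (simp add: prod_form_def case_prod_unfold)
      qed
      moreover have "snd x = 0"
      proof (rule W.nondegenerate[OF xVW(2)])
        fix w assume "w \<in> W"
        then show "\<eta> (snd x) w = 0"
          using 0[rule_format, of "(0, w)"] V.V_closed(1) V.zero_right[OF xVW(1)]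
          by (simp add: prod_form_def case_prod_unfold)
      qed
      ultimately show ?thesis by (simp add: prod_eq_iff)
    qed
  qed (auto simp: prod_form_def V.add_left W.add_left V.scale_left W.scale_left algebra_simps)
qed

lemma lagrangian_Times:
  assumes "symplectic_space V \<omega>" "symplectic_space W \<eta>"
    and "A \<in> lagrangians V \<omega>" "B \<in> lagrangians W \<eta>"
  shows "A \<times> B \<in> lagrangians (V \<times> W) (prod_form \<omega> \<eta>)"
proof -
  interpret V: symplectic V \<omega> by (rule symplectic.intro[OF assms(1)])
  interpret W: symplectic W \<eta> by (rule symplectic.intro[OF assms(2)])
  interpret VW: symplectic "V \<times> W" "prod_form \<omega> \<eta>"
    by (rule symplectic.intro[OF symplectic_space_prod[OF assms(1,2)]])
  note A = V.lagrangianD[OF assms(3)] and B = W.lagrangianD[OF assms(4)]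
  show ?thesis
  proof (rule VW.lagrangianI)
    show "VW.isotropic (A \<times> B)"
      unfolding VW.isotropic_def
      using subspace_Times[OF A(1) B(1)] Sigma_mono[of A V "\<lambda>_. B" "\<lambda>_. W"] A(2,6) B(2,6)
      by (auto simp: prod_form_def)
    show "dim (V \<times> W) \<le> 2 * dim (A \<times> B)"
      using A(1,5) B(1,5) by (simp add: dim_Times V.subspace_V W.subspace_V)
  qed
qed

lemma codim_Times:
  assumes "subspace A" "subspace B" "subspace A'" "subspace B'"
  shows "codim (A \<times> B) (A' \<times> B') = codim A A' + codim B B'"
proof -
  have "dim (A \<inter> A') \<le> dim A" "dim (B \<inter> B') \<le> dim B" by (auto intro: dim_subset)
  then show ?thesis
    using assms by (simp add: codim_def Times_Int_Times dim_Times subspace_inter)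
qed

lemma norm_Pair_le_scaled:
  assumes "norm a \<le> \<delta> * norm x" "norm b \<le> \<delta> * norm y" "\<delta> \<ge> 0"
  shows "norm (a, b) \<le> \<delta> * norm (x, y)"
proof -
  have "(norm a)\<^sup>2 + (norm b)\<^sup>2 \<le> (\<delta> * norm x)\<^sup>2 + (\<delta> * norm y)\<^sup>2"
    using assms by (intro add_mono power_mono) auto
  also have "\<dots> = \<delta>\<^sup>2 * ((norm x)\<^sup>2 + (norm y)\<^sup>2)" by (simp add: power_mult_distrib distrib_left)
  finally show ?thesis
    using assms(3) real_sqrt_le_mono by (fastforce simp: norm_Pair real_sqrt_mult)
qed

lemma symplectic_perturbation_map_prod:
  assumes V: "symplectic V \<omega>" and W: "symplectic W \<eta>" and "\<delta> \<ge> 0"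
    and S: "symplectic.symplectic_perturbation V \<omega> \<delta> S"
    and T: "symplectic.symplectic_perturbation W \<eta> \<delta> T"
  shows "symplectic.symplectic_perturbation (V \<times> W) (prod_form \<omega> \<eta>) \<delta> (map_prod S T)"
proof -
  interpret V: symplectic V \<omega> by (rule V)
  interpret W: symplectic W \<eta> by (rule W)
  interpret VW: symplectic "V \<times> W" "prod_form \<omega> \<eta>"
    by (rule symplectic.intro[OF symplectic_space_prod[OF V.symplectic W.symplectic]])
  note S = V.symplectic_perturbationD[OF S] and T = W.symplectic_perturbationD[OF T]
  show ?thesis
    unfolding VW.symplectic_perturbation_def
  proof (intro conjI ballI)
    show "linear (map_prod S T)"
      by (rule linearI) (auto simp: linear_add[OF S(1)] linear_add[OF T(1)]
          linear_cmul[OF S(1)] linear_cmul[OF T(1)])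
    show "map_prod S T ` (V \<times> W) \<subseteq> V \<times> W" using S(2) T(2) by auto
    show "prod_form \<omega> \<eta> (map_prod S T x) (map_prod S T y) = prod_form \<omega> \<eta> x y"
      if "x \<in> V \<times> W" "y \<in> V \<times> W" for x y
      using that S(3) T(3) by (auto simp: prod_form_def)
    show "norm (map_prod S T x - x) \<le> \<delta> * norm x" if "x \<in> V \<times> W" for x
      using that \<open>\<delta> \<ge> 0\<close> by (auto simp: minus_prod_def intro!: norm_Pair_le_scaled S(4) T(4))
  qed
qed

lemma opp_form_apply: "opp_form \<omega> x y = - \<omega> x y"
  by (simp add: opp_form_def)

lemma prod_form_apply: "prod_form \<omega> \<eta> (x, y) (x', y') = \<omega> x x' + \<eta> y y'"
  by (simp add: prod_form_def)

locale composable =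
  X: symplectic X \<omega>X + Y: symplectic Y \<omega>Y + Z: symplectic Z \<omega>Z
  for X :: "'a::euclidean_space set" and \<omega>X and Y :: "'b::euclidean_space set" and \<omega>Y
    and Z :: "'c::euclidean_space set" and \<omega>Z
begin

abbreviation \<omega>XY :: "'a \<times> 'b \<Rightarrow> 'a \<times> 'b \<Rightarrow> real" where "\<omega>XY \<equiv> prod_form \<omega>X (opp_form \<omega>Y)"
abbreviation \<omega>YZ :: "'b \<times> 'c \<Rightarrow> 'b \<times> 'c \<Rightarrow> real" where "\<omega>YZ \<equiv> prod_form \<omega>Y (opp_form \<omega>Z)"
abbreviation \<omega>XZ :: "'a \<times> 'c \<Rightarrow> 'a \<times> 'c \<Rightarrow> real" where "\<omega>XZ \<equiv> prod_form \<omega>X (opp_form \<omega>Z)"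

text \<open>\<open>X\<close> and \<open>Z\<close> times the diagonal of \<open>Y\<close>: the coisotropic subspace along which composition is
  the reduction, with reduction map \<open>outer\<close>.\<close>

definition matching :: "(('a \<times> 'b) \<times> ('b \<times> 'c)) set" where
  "matching = {((x, y), (y', z)) | x y y' z. x \<in> X \<and> y \<in> Y \<and> z \<in> Z \<and> y' = y}"

definition outer :: "('a \<times> 'b) \<times> ('b \<times> 'c) \<Rightarrow> 'a \<times> 'c" where
  "outer = (\<lambda>((x, y), (y', z)). (x, z))"

sublocale XY: symplectic "X \<times> Y" \<omega>XY
  by (intro symplectic.intro symplectic_space_prod symplectic_space_opp X.symplectic Y.symplectic)

sublocale YZ: symplectic "Y \<times> Z" \<omega>YZ
  by (intro symplectic.intro symplectic_space_prod symplectic_space_opp Y.symplectic Z.symplectic)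

sublocale XZ: symplectic "X \<times> Z" \<omega>XZ
  by (intro symplectic.intro symplectic_space_prod symplectic_space_opp X.symplectic Z.symplectic)

sublocale XYYZ: symplectic "(X \<times> Y) \<times> (Y \<times> Z)" "prod_form \<omega>XY \<omega>YZ"
  by (intro symplectic.intro symplectic_space_prod XY.symplectic YZ.symplectic)

text \<open>Testing against \<open>(a, 0, 0, 0)\<close>, \<open>(0, 0, 0, c)\<close> and \<open>(0, b, b, 0)\<close> isolates the three conditions,
  the last one through the opposite signs of the form on the two copies of \<open>Y\<close>.\<close>

lemma matching_orth: "XYYZ.orth matching = {((0, y), (y, 0)) | y. y \<in> Y}"
proof (intro equalityI subsetI)
  fix v assume v: "v \<in> XYYZ.orth matching"
  obtain x y y' z where v': "v = ((x, y), (y', z))" by (metis surj_pair)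
  have mem: "x \<in> X" "y \<in> Y" "y' \<in> Y" "z \<in> Z"
    using v v' by (auto simp: symplectic_orthogonal_def)
  have eq: "\<omega>X x a - \<omega>Y y b + (\<omega>Y y' b - \<omega>Z z c) = 0" if "a \<in> X" "b \<in> Y" "c \<in> Z" for a b c
  proof -
    have "((a, b), (b, c)) \<in> matching" using that by (simp add: matching_def)
    then have "prod_form \<omega>XY \<omega>YZ v ((a, b), (b, c)) = 0"
      using v unfolding symplectic_orthogonal_def by blast
    then show ?thesis by (simp add: v' prod_form_apply opp_form_apply)
  qed
  note zero = X.V_closed(1) Y.V_closed(1) Z.V_closed(1)
  note vanish = X.zero_right[OF mem(1)] Y.zero_right[OF mem(2)] Y.zero_right[OF mem(3)] Z.zero_right[OF mem(4)]
  have "x = 0" using eq[OF _ zero(2,3)] vanish by (intro X.nondegenerate[OF mem(1)]) simp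
  moreover have "z = 0" using eq[OF zero(1,2)] vanish by (intro Z.nondegenerate[OF mem(4)]) simp
  moreover have "y - y' = 0"
  proof (rule Y.nondegenerate[OF Y.V_closed(3)[OF mem(2,3)]])
    show "\<omega>Y (y - y') b = 0" if "b \<in> Y" for b
      using eq[OF zero(1) that zero(3)] vanish by (simp add: Y.diff_left[OF mem(2,3) that])
  qed
  ultimately show "v \<in> {((0, y), (y, 0)) | y. y \<in> Y}" using v' mem by simp
next
  fix v :: "('a \<times> 'b) \<times> ('b \<times> 'c)" assume "v \<in> {((0, y), (y, 0)) | y. y \<in> Y}"
  then obtain y where y: "y \<in> Y" "v = ((0, y), (y, 0))" by blast
  then show "v \<in> XYYZ.orth matching"
    using X.V_closed(1) Z.V_closed(1)
    by (auto simp: symplectic_orthogonal_def matching_def prod_form_apply opp_form_apply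
        X.zero_left Z.zero_left)
qed

sublocale symplectic_reduction "(X \<times> Y) \<times> (Y \<times> Z)" "prod_form \<omega>XY \<omega>YZ" "X \<times> Z" \<omega>XZ matching outer
proof (intro symplectic_reduction.intro symplectic_reduction_axioms.intro)
  show "symplectic ((X \<times> Y) \<times> (Y \<times> Z)) (prod_form \<omega>XY \<omega>YZ)" "symplectic (X \<times> Z) \<omega>XZ"
    by unfold_locales
  show "subspace matching"
    unfolding subspace_def matching_def zero_prod_def
    by (auto simp: X.V_closed Y.V_closed Z.V_closed)
  show "matching \<subseteq> (X \<times> Y) \<times> (Y \<times> Z)" by (auto simp: matching_def)
  show "XYYZ.orth matching \<subseteq> matching"
    unfolding matching_orth by (auto simp: matching_def X.V_closed(1) Z.V_closed(1))
  show "linear outer" by (rule linearI) (auto simp: outer_def)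
  show "outer ` matching = X \<times> Z"
    using Y.V_closed(1) by (force simp: outer_def matching_def image_iff)
  show "\<omega>XZ (outer u) (outer v) = prod_form \<omega>XY \<omega>YZ u v" if "u \<in> matching" "v \<in> matching" for u v
    using that by (auto simp: matching_def outer_def prod_form_apply opp_form_apply)
qed

lemma red_Times:
  assumes "f \<subseteq> X \<times> Y" "g \<subseteq> Y \<times> Z"
  shows "red (f \<times> g) = f O g"
proof (intro equalityI subsetI)
  fix u assume "u \<in> red (f \<times> g)"
  then show "u \<in> f O g" by (auto simp: matching_def outer_def)
next
  fix u assume "u \<in> f O g"
  then obtain x y z where u: "u = (x, z)" "(x, y) \<in> f" "(y, z) \<in> g" by auto
  then have "((x, y), (y, z)) \<in> (f \<times> g) \<inter> matching" using assms by (auto simp: matching_def)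
  then show "u \<in> red (f \<times> g)" unfolding u(1) by (rule rev_image_eqI) (simp add: outer_def)
qed

lemma excess_eq:
  assumes "subspace f" "subspace g"
  shows "dim ((f \<times> g) \<inter> I) = excess Y f g"
proof -
  define j :: "'b \<Rightarrow> ('a \<times> 'b) \<times> ('b \<times> 'c)" where "j = (\<lambda>y. ((0, y), (y, 0)))"
  let ?E = "{y \<in> Y. (0, y) \<in> f \<and> (y, 0) \<in> g}"
  have "linear j" by (rule linearI) (auto simp: j_def zero_prod_def)
  moreover have "inj j" by (auto simp: j_def inj_def)
  ultimately have "dim (j ` ?E) = dim ?E" by (intro dim_image_eq) (auto intro: inj_on_subset)
  moreover have "j ` ?E = (f \<times> g) \<inter> I" unfolding matching_orth by (auto simp: j_def)
  ultimately show ?thesis by (simp add: excess_def)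
qed

abbreviation lagXY :: "('a \<times> 'b) set set" where "lagXY \<equiv> lagrangians (X \<times> Y) \<omega>XY"
abbreviation lagYZ :: "('b \<times> 'c) set set" where "lagYZ \<equiv> lagrangians (Y \<times> Z) \<omega>YZ"
abbreviation lagXZ :: "('a \<times> 'c) set set" where "lagXZ \<equiv> lagrangians (X \<times> Z) \<omega>XZ"

lemma lagrangian_pair:
  assumes "f \<in> lagXY" "g \<in> lagYZ"
  shows "f \<times> g \<in> lagrangians ((X \<times> Y) \<times> (Y \<times> Z)) (prod_form \<omega>XY \<omega>YZ)"
    "red (f \<times> g) = f O g" "dim ((f \<times> g) \<inter> I) = excess Y f g"
  using lagrangian_Times[OF XY.symplectic YZ.symplectic assms]
    red_Times[OF XY.lagrangianD(2)[OF assms(1)] YZ.lagrangianD(2)[OF assms(2)]]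
    excess_eq[OF XY.lagrangianD(1)[OF assms(1)] YZ.lagrangianD(1)[OF assms(2)]] by auto

lemma comp_lagrangian:
  assumes "f \<in> lagXY" "g \<in> lagYZ"
  shows "f O g \<in> lagXZ"
  using red_lagrangian[OF lagrangian_pair(1)[OF assms]] lagrangian_pair(2)[OF assms] by simp

lemma codim_comp:
  assumes "f \<in> lagXY" "g \<in> lagYZ" "f' \<in> lagXY" "g' \<in> lagYZ"
  shows "codim (f O g) (f' O g') + excess Y f' g' \<le> codim f f' + codim g g' + excess Y f g"
proof -
  have "codim (f \<times> g) (f' \<times> g') = codim f f' + codim g g'"
    by (intro codim_Times XY.lagrangianD(1) YZ.lagrangianD(1) assms)
  then show ?thesis
    using codim_red[OF lagrangian_pair(1)[OF assms(1,2)] lagrangian_pair(1)[OF assms(3,4)]]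
      lagrangian_pair(2,3)[OF assms(1,2)] lagrangian_pair(2,3)[OF assms(3,4)] by simp
qed

text \<open>Nearby pairs are images of \<open>f \<times> g\<close> under products of perturbations, so the behaviour of reduction
  under perturbations of \<open>V\<close> suffices; the Lagrangians it provides in \<open>V\<close> need not be products.\<close>

lemma comp_locally:
  assumes fg: "f \<in> lagXY" "g \<in> lagYZ"
    and O': "openin (lagrangian_topology (X \<times> Z) \<omega>XZ) O'" "f O g \<in> O'"
  obtains N N' where "openin (lagrangian_topology (X \<times> Y) \<omega>XY) N" "f \<in> N"
    "openin (lagrangian_topology (Y \<times> Z) \<omega>YZ) N'" "g \<in> N'"
    "\<And>f' g'. f' \<in> N \<Longrightarrow> g' \<in> N' \<Longrightarrow>
       \<exists>M\<in>O'. codim M (f' O g') + excess Y f' g' \<le> excess Y f g"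
proof -
  have "red (f \<times> g) \<in> O'" using O'(2) lagrangian_pair(2)[OF fg] by simp
  then obtain \<delta> where \<delta>: "\<delta> > 0"
    "\<And>T. XYYZ.symplectic_perturbation \<delta> T \<Longrightarrow>
       \<exists>M\<in>O'. codim M (red (T ` (f \<times> g))) + dim (T ` (f \<times> g) \<inter> I) \<le> dim ((f \<times> g) \<inter> I)"
    using red_perturbation[OF lagrangian_pair(1)[OF fg] O'(1)] by blast
  obtain N where N: "openin (lagrangian_topology (X \<times> Y) \<omega>XY) N" "f \<in> N"
    "\<And>f'. f' \<in> N \<Longrightarrow> \<exists>T. XY.symplectic_perturbation \<delta> T \<and> T ` f = f'"
    using XY.nearby_lagrangian_is_perturbation[OF fg(1) \<delta>(1)] by blast
  obtain N' where N': "openin (lagrangian_topology (Y \<times> Z) \<omega>YZ) N'" "g \<in> N'"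
    "\<And>g'. g' \<in> N' \<Longrightarrow> \<exists>T. YZ.symplectic_perturbation \<delta> T \<and> T ` g = g'"
    using YZ.nearby_lagrangian_is_perturbation[OF fg(2) \<delta>(1)] by blast
  show ?thesis
  proof (rule that[OF N(1,2) N'(1,2)])
    fix f' g' assume f': "f' \<in> N" and g': "g' \<in> N'"
    obtain S T where ST: "XY.symplectic_perturbation \<delta> S" "S ` f = f'"
      "YZ.symplectic_perturbation \<delta> T" "T ` g = g'"
      using N(3)[OF f'] N'(3)[OF g'] by auto
    have lag: "f' \<in> lagXY" "g' \<in> lagYZ"
      using XY.lagrangian_open_subset[OF N(1)] YZ.lagrangian_open_subset[OF N'(1)] f' g' by auto
    have "XYYZ.symplectic_perturbation \<delta> (map_prod S T)"
      using \<delta>(1) ST(1,3) XY.symplectic_axioms YZ.symplectic_axioms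
      by (intro symplectic_perturbation_map_prod) auto
    moreover have "map_prod S T ` (f \<times> g) = f' \<times> g'" using ST(2,4) by (simp add: map_prod_surj_on)
    ultimately show "\<exists>M\<in>O'. codim M (f' O g') + excess Y f' g' \<le> excess Y f g"
      using \<delta>(2)[of "map_prod S T"] lagrangian_pair(2,3)[OF lag] lagrangian_pair(3)[OF fg] by simp
  qed
qed

end

section \<open>Continuity in the Sabot topologies\<close>

context symplectic
begin

lemma sublevel_iff:
  "(M, j) \<in> sublevel V \<omega> (L, k) \<longleftrightarrow> M \<in> lagrangians V \<omega> \<and> codim L M + j \<le> k"
  by (auto simp: sublevel_def indexed_lagrangians_def)

lemma sublevel_refl: "L \<in> lagrangians V \<omega> \<Longrightarrow> (L, k) \<in> sublevel V \<omega> (L, k)"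
  by (simp add: sublevel_iff codim_def)

lemma openin_sabot_topology:
  "openin (lagrangian_topology V \<omega>) U \<Longrightarrow>
    openin (sabot_topology V \<omega>) (\<Union>p\<in>U \<times> {k}. sublevel V \<omega> p)"
  unfolding sabot_topology_def by (intro topology_generated_by_Basis) blast

lemma topspace_sabot_topology: "topspace (sabot_topology V \<omega>) = lagrangians V \<omega> \<times> UNIV"
proof (intro equalityI subsetI)
  fix q assume "q \<in> topspace (sabot_topology V \<omega>)"
  then show "q \<in> lagrangians V \<omega> \<times> UNIV"
    by (auto simp: sabot_topology_def topology_generated_by_topspace sublevel_def indexed_lagrangians_def)
next
  fix q assume "q \<in> lagrangians V \<omega> \<times> (UNIV :: nat set)"
  then obtain L k where q: "q = (L, k)" "L \<in> lagrangians V \<omega>" by auto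
  have "openin (sabot_topology V \<omega>) (\<Union>p\<in>lagrangians V \<omega> \<times> {k}. sublevel V \<omega> p)"
    using openin_topspace[of "lagrangian_topology V \<omega>"]
    by (intro openin_sabot_topology) (simp add: topspace_lagrangian_topology)
  moreover have "q \<in> (\<Union>p\<in>lagrangians V \<omega> \<times> {k}. sublevel V \<omega> p)"
    using q sublevel_refl by auto
  ultimately show "q \<in> topspace (sabot_topology V \<omega>)" using openin_subset by blast
qed

end

theorem theorem8p9:
  fixes X :: "'a::euclidean_space set" and \<omega>X :: "'a \<Rightarrow> 'a \<Rightarrow> real"
    and Y :: "'b::euclidean_space set" and \<omega>Y :: "'b \<Rightarrow> 'b \<Rightarrow> real"
    and Z :: "'c::euclidean_space set" and \<omega>Z :: "'c \<Rightarrow> 'c \<Rightarrow> real"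
  assumes "symplectic_space X \<omega>X" and "symplectic_space Y \<omega>Y" and "symplectic_space Z \<omega>Z"
  shows "continuous_map
    (prod_topology
      (sabot_topology (X \<times> Y) (prod_form \<omega>X (opp_form \<omega>Y)))
      (sabot_topology (Y \<times> Z) (prod_form \<omega>Y (opp_form \<omega>Z))))
    (sabot_topology (X \<times> Z) (prod_form \<omega>X (opp_form \<omega>Z)))
    (indexed_comp Y)"
proof -
  interpret composable X \<omega>X Y \<omega>Y Z \<omega>Z
    using assms by (intro composable.intro symplectic.intro)
  let ?S = "prod_topology (sabot_topology (X \<times> Y) \<omega>XY) (sabot_topology (Y \<times> Z) \<omega>YZ)"
  let ?F = "{\<Union>p\<in>U \<times> {k}. sublevel (X \<times> Z) \<omega>XZ p | U k. openin (lagrangian_topology (X \<times> Z) \<omega>XZ) U}"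
  have top: "topspace ?S = (lagXY \<times> UNIV) \<times> (lagYZ \<times> UNIV)"
    by (simp add: XY.topspace_sabot_topology YZ.topspace_sabot_topology)
  show ?thesis
    unfolding sabot_topology_def[of "X \<times> Z"]
  proof (rule continuous_on_generated_topo)
    have "indexed_comp Y ` topspace ?S \<subseteq> topspace (sabot_topology (X \<times> Z) \<omega>XZ)"
      unfolding top XZ.topspace_sabot_topology by (auto simp: indexed_comp_def comp_lagrangian)
    then show "indexed_comp Y ` topspace ?S \<subseteq> \<Union>?F"
      unfolding sabot_topology_def[of "X \<times> Z"] topology_generated_by_topspace .
  next
    fix B assume "B \<in> ?F"
    then obtain U k where U: "openin (lagrangian_topology (X \<times> Z) \<omega>XZ) U"
      and B: "B = (\<Union>p\<in>U \<times> {k}. sublevel (X \<times> Z) \<omega>XZ p)" by blast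
    show "openin ?S (indexed_comp Y -` B \<inter> topspace ?S)"
    proof (subst openin_subopen, intro ballI)
      fix q assume q: "q \<in> indexed_comp Y -` B \<inter> topspace ?S"
      obtain f i g j where q': "q = ((f, i), (g, j))" by (metis surj_pair)
      have fg: "f \<in> lagXY" "g \<in> lagYZ" using q unfolding q' top by auto
      obtain K where K: "K \<in> U" "codim K (f O g) + (i + j + excess Y f g) \<le> k"
        using q unfolding q' B by (auto simp: indexed_comp_def XZ.sublevel_iff)
      obtain O' where O': "openin (lagrangian_topology (X \<times> Z) \<omega>XZ) O'" "f O g \<in> O'"
        "\<And>M. M \<in> O' \<Longrightarrow> \<exists>K'\<in>U. codim K' M \<le> codim K (f O g)"
        using XZ.nearby_lagrangian_within_codim[OF U K(1) comp_lagrangian[OF fg]] by blast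
      obtain N N' where N: "openin (lagrangian_topology (X \<times> Y) \<omega>XY) N" "f \<in> N"
        and N': "openin (lagrangian_topology (Y \<times> Z) \<omega>YZ) N'" "g \<in> N'"
        and near: "\<And>f' g'. f' \<in> N \<Longrightarrow> g' \<in> N' \<Longrightarrow>
           \<exists>M\<in>O'. codim M (f' O g') + excess Y f' g' \<le> excess Y f g"
        by (rule comp_locally[OF fg O'(1,2)]) blast
      let ?T = "(\<Union>p\<in>N \<times> {i}. sublevel (X \<times> Y) \<omega>XY p) \<times> (\<Union>p\<in>N' \<times> {j}. sublevel (Y \<times> Z) \<omega>YZ p)"
      have "openin ?S ?T"
        by (intro openin_prod_Times_iff[THEN iffD2] disjI2 conjI
            XY.openin_sabot_topology YZ.openin_sabot_topology N(1) N'(1))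
      moreover have "q \<in> ?T"
        unfolding q' using N(2) N'(2) XY.sublevel_refl[OF fg(1)] YZ.sublevel_refl[OF fg(2)] by auto
      moreover have "?T \<subseteq> indexed_comp Y -` B \<inter> topspace ?S"
      proof (rule subsetI)
        fix r assume r: "r \<in> ?T"
        obtain f1 i1 g1 j1 where r': "r = ((f1, i1), (g1, j1))" by (metis surj_pair)
        obtain f' g' where f': "f' \<in> N" "f1 \<in> lagXY" "codim f' f1 + i1 \<le> i"
          and g': "g' \<in> N'" "g1 \<in> lagYZ" "codim g' g1 + j1 \<le> j"
          using r unfolding r' by (auto simp: XY.sublevel_iff YZ.sublevel_iff)
        have lag': "f' \<in> lagXY" "g' \<in> lagYZ"
          using XY.lagrangian_open_subset[OF N(1)] YZ.lagrangian_open_subset[OF N'(1)] f'(1) g'(1) by auto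
        obtain M where M: "M \<in> O'" "codim M (f' O g') + excess Y f' g' \<le> excess Y f g"
          using near[OF f'(1) g'(1)] by blast
        obtain K' where K': "K' \<in> U" "codim K' M \<le> codim K (f O g)" using O'(3)[OF M(1)] by blast
        have lag: "K' \<in> lagXZ" "M \<in> lagXZ" "f' O g' \<in> lagXZ" "f1 O g1 \<in> lagXZ"
          using XZ.lagrangian_open_subset[OF U] XZ.lagrangian_open_subset[OF O'(1)] K'(1) M(1)
            comp_lagrangian[OF lag'] comp_lagrangian[OF f'(2) g'(2)] by auto
        have triangle: "codim A C' \<le> codim A B' + codim B' C'"
          if "A \<in> lagXZ" "B' \<in> lagXZ" "C' \<in> lagXZ" for A B' C'
          using XZ.lagrangianD(1,5)[OF that(1)] XZ.lagrangianD(1,5)[OF that(2)]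
            XZ.lagrangianD(1)[OF that(3)] by (intro codim_triangle) auto
        \<comment> \<open>The excess of \<open>(f', g')\<close> cancels between the bound for \<open>M\<close> and the one for \<open>(f1, g1)\<close>.\<close>
        have "codim K' (f1 O g1) + (i1 + j1 + excess Y f1 g1) \<le> k"
          using triangle[OF lag(1,2,4)] triangle[OF lag(2,3,4)] K'(2) M(2) K(2) f'(3) g'(3)
            codim_comp[OF lag' f'(2) g'(2)] by linarith
        then have "indexed_comp Y r \<in> B"
          unfolding r' B using K'(1) lag(4) by (auto simp: indexed_comp_def XZ.sublevel_iff)
        then show "r \<in> indexed_comp Y -` B \<inter> topspace ?S"
          unfolding top using f'(2) g'(2) by (simp add: r')
      qed
      ultimately show "\<exists>T. openin ?S T \<and> q \<in> T \<and> T \<subseteq> indexed_comp Y -` B \<inter> topspace ?S"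
        by blast
    qed
  qed
qed

end
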